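(* Let $\mu$ be a self-similar measure of finite type (setting described in the context), with support $K$ of Hausdorff dimension $s$. Then the set of points of $K$ that are not truly essential is contained in a closed set $C$ with $\mu(C)=0$ and $H^s(C)=0$, where $H^s$ denotes $s$-dimensional Hausdorff measure restricted to $K$ and normalized so that $H^s(K)=1$.
   Context: Setting. Let $m\ge 1$ be an integer, $0<\varrho<1$, $0=d_0<d_1<\dots<d_m$, $S_j(x)=\varrho x+d_j$ for $j\in\mathcal A=\{0,\dots,m\}$. Let $K$ be the unique non-empty compact set with $K=\bigcup_j S_j(K)$; the $d_j$ are scaled so that the convex hull of $K$ is $[0,1]$ ($K$ need not be an interval). For $\sigma=(j_1,\dots,j_n)\in\mathcal A^n$ put $S_\sigma=S_{j_1}\circ\cdots\circ S_{j_n}$. The IFS is of finite type if there is a finite set $F\subseteq\mathbb R$ such that for every $n\ge1$ and all $\sigma,\sigma'\in\mathcal A^n$, either $\varrho^{-n}|S_\sigma(0)-S_{\sigma'}(0)|>1$ or $\varrho^{-n}(S_\sigma(0)-S_{\sigma'}(0))\in F$. Given $p_j>0$ with $\sum_j p_j=1$, $\mu$ is the unique Borel probability measure with $\mu=\sum_j p_j\,\mu\circ S_j^{-1}$; its support is $K$; $\mu$ is called of finite type if the IFS is. It is known that for finite type IFS $0<\mathcal H^s(K)<\infty$ with $s=\dim_H K$. Net intervals. Let $h_1<\dots<h_{s_n}$ be the elements of $\{S_\sigma(0),S_\sigma(1):\sigma\in\mathcal A^n\}$; $\mathcal F_n$ (net intervals of level $n$) is the set of $[h_j,h_{j+1}]$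 with $(h_j,h_{j+1})\cap K\ne\emptyset$; $\mathcal F_0=\{[0,1]\}$. Each $\Delta\in\mathcal F_n$, $n\ge1$, is contained in a unique $\widehat\Delta\in\mathcal F_{n-1}$, its parent ($\Delta$ is a child of $\widehat\Delta$). For $\Delta=[a,b]\in\mathcal F_n$: normalized length $\ell_n(\Delta)=\varrho^{-n}(b-a)$; neighbour set $V_n(\Delta)$ = the increasingly ordered tuple of the distinct elements of $\{\varrho^{-n}(a-S_\sigma(0)):\sigma\in\mathcal A^n,\ \Delta\subseteq S_\sigma[0,1]\}$; $r_n(\Delta)$ = position of $\Delta$, from left to right, among the level $n$ net intervals with the same parent and the same normalized length. The characteristic vector is $\mathcal C_n(\Delta)=(\ell_n(\Delta),V_n(\Delta),r_n(\Delta))$. Under finite type the set $\Omega$ of characteristic vectors is finite, and the characteristic vectors of the children of $\Delta$ depend only on that of $\Delta$, so one may speak of children of characteristic vectors. An admissible path is a finite sequence of characteristic vectors, each being the parent of the next. A loop class is a non-empty $\Omega'\subseteq\Omega$ such that any $\alpha,\beta\in\Omega'$ are joined by an admissible path from $\alpha$ to $\beta$ inside $\Omega'$; it is an essential class if in addition all children of elements of $\Omega'$ are in $\Omega'$. There is exactly one essential class $\Omega_0$ (known). A net interval is essential if its characteristic vector is in $\Omega_0$. Truly essential points. $x\in K$ is a boundary point if it is an endpoint of a net interval $\Delta_n(x)\ni x$ of some level $n$. If $x$ is an endpoint of $\Delta_n(x)=[h_i,h_{i+1}]\in\mathcal F_n$, the other net interval $\Delta_n'(x)$ is the level $n$ net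 interval on the other side of $x$ having $x$ as an endpoint (the empty set if there is none). $x$ is a boundary essential point if for some $n$ it is an endpoint of $\Delta_n(x)\in\mathcal F_n$ and both $\Delta_n(x)$ and $\Delta_n'(x)$ are essential (the empty set counting as essential). $x$ is an interior essential point if it is not a boundary point and it lies in the interior of some essential net interval. $x$ is truly essential if it is a boundary essential or an interior essential point. *)

theory Defs
  imports "HOL-Probability.Probability"
begin

text \<open>Throughout, the alphabet is \<open>{..m}\<close>, words are lists of letters, and \<open>K\<close> is the attractor.\<close>

definition ifs_map :: "real \<Rightarrow> (nat \<Rightarrow> real) \<Rightarrow> nat \<Rightarrow> real \<Rightarrow> real" where
  "ifs_map \<rho> d j x = \<rho> * x + d j"

primrec word_map :: "real \<Rightarrow> (nat \<Rightarrow> real) \<Rightarrow> nat list \<Rightarrow> real \<Rightarrow> real" where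
  "word_map \<rho> d [] = id"
| "word_map \<rho> d (j # \<sigma>) = ifs_map \<rho> d j \<circ> word_map \<rho> d \<sigma>"

definition words :: "nat \<Rightarrow> nat \<Rightarrow> nat list set" where
  "words m n = {\<sigma>. length \<sigma> = n \<and> set \<sigma> \<subseteq> {..m}}"

definition is_attractor :: "nat \<Rightarrow> real \<Rightarrow> (nat \<Rightarrow> real) \<Rightarrow> real set \<Rightarrow> bool" where
  "is_attractor m \<rho> d K \<longleftrightarrow>
     compact K \<and> K \<noteq> {} \<and> K = (\<Union>j\<le>m. ifs_map \<rho> d j ` K)"

definition finite_type :: "nat \<Rightarrow> real \<Rightarrow> (nat \<Rightarrow> real) \<Rightarrow> bool" where
  "finite_type m \<rho> d \<longleftrightarrow>
     (\<exists>F. finite F \<and>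
        (\<forall>n\<ge>1. \<forall>\<sigma>\<in>words m n. \<forall>\<tau>\<in>words m n.
           \<bar>word_map \<rho> d \<sigma> 0 - word_map \<rho> d \<tau> 0\<bar> / \<rho> ^ n > 1 \<or>
           (word_map \<rho> d \<sigma> 0 - word_map \<rho> d \<tau> 0) / \<rho> ^ n \<in> F))"

definition self_similar_measure ::
  "nat \<Rightarrow> real \<Rightarrow> (nat \<Rightarrow> real) \<Rightarrow> (nat \<Rightarrow> real) \<Rightarrow> real measure \<Rightarrow> bool" where
  "self_similar_measure m \<rho> d p \<mu> \<longleftrightarrow>
     prob_space \<mu> \<and> sets \<mu> = sets borel \<and>
     (\<forall>A\<in>sets borel.
        emeasure \<mu> A = (\<Sum>j\<le>m. ennreal (p j) * emeasure (distr \<mu> borel (ifs_map \<rho> d j)) A))"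


section \<open>Net intervals and characteristic vectors\<close>

definition net_points :: "nat \<Rightarrow> real \<Rightarrow> (nat \<Rightarrow> real) \<Rightarrow> nat \<Rightarrow> real set" where
  "net_points m \<rho> d n = (\<Union>\<sigma>\<in>words m n. {word_map \<rho> d \<sigma> 0, word_map \<rho> d \<sigma> 1})"

text \<open>The endpoints of a net interval \<open>\<Delta>\<close> are recovered as \<open>Inf \<Delta>\<close> and \<open>Sup \<Delta>\<close>. The same set
  can be a net interval of several levels, with different characteristic vectors, so the level is
  always passed explicitly.\<close>

definition net_intervals ::
  "nat \<Rightarrow> real \<Rightarrow> (nat \<Rightarrow> real) \<Rightarrow> real set \<Rightarrow> nat \<Rightarrow> real set set" where
  "net_intervals m \<rho> d K n =
     (if n = 0 then {{0..1}}
      else {{a..b} | a b. a \<in> net_points m \<rho> d n \<and> b \<in> net_points m \<rho> d n \<and> a < b \<and>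
                          {a<..<b} \<inter> net_points m \<rho> d n = {} \<and> {a<..<b} \<inter> K \<noteq> {}})"

definition net_child ::
  "nat \<Rightarrow> real \<Rightarrow> (nat \<Rightarrow> real) \<Rightarrow> real set \<Rightarrow> nat \<Rightarrow> real set \<Rightarrow> real set \<Rightarrow> bool" where
  "net_child m \<rho> d K n \<Delta>' \<Delta> \<longleftrightarrow>
     \<Delta>' \<in> net_intervals m \<rho> d K n \<and> \<Delta> \<in> net_intervals m \<rho> d K (Suc n) \<and> \<Delta> \<subseteq> \<Delta>'"

definition norm_length :: "real \<Rightarrow> nat \<Rightarrow> real set \<Rightarrow> real" where
  "norm_length \<rho> n \<Delta> = (Sup \<Delta> - Inf \<Delta>) / \<rho> ^ n"

definition neighbour_set :: "nat \<Rightarrow> real \<Rightarrow> (nat \<Rightarrow> real) \<Rightarrow> nat \<Rightarrow> real set \<Rightarrow> real list" where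
  "neighbour_set m \<rho> d n \<Delta> =
     sorted_list_of_set
       {(Inf \<Delta> - word_map \<rho> d \<sigma> 0) / \<rho> ^ n | \<sigma>.
          \<sigma> \<in> words m n \<and> \<Delta> \<subseteq> word_map \<rho> d \<sigma> ` {0..1}}"

text \<open>The position counts from \<open>1\<close>; the net interval of level \<open>0\<close>, which has no parent, gets
  position \<open>1\<close>, so that its characteristic vector is \<open>(1, [0], 1)\<close>.\<close>

definition net_position ::
  "nat \<Rightarrow> real \<Rightarrow> (nat \<Rightarrow> real) \<Rightarrow> real set \<Rightarrow> nat \<Rightarrow> real set \<Rightarrow> nat" where
  "net_position m \<rho> d K n \<Delta> =
     (case n of
        0 \<Rightarrow> 1
      | Suc k \<Rightarrow>
          card {\<Gamma>. (\<exists>\<Delta>'. net_child m \<rho> d K k \<Delta>' \<Delta> \<and> net_child m \<rho> d K k \<Delta>' \<Gamma>) \<and>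
                    norm_length \<rho> n \<Gamma> = norm_length \<rho> n \<Delta> \<and> Inf \<Gamma> \<le> Inf \<Delta>})"

type_synonym char_vec = "real \<times> real list \<times> nat"

definition char_vector ::
  "nat \<Rightarrow> real \<Rightarrow> (nat \<Rightarrow> real) \<Rightarrow> real set \<Rightarrow> nat \<Rightarrow> real set \<Rightarrow> char_vec" where
  "char_vector m \<rho> d K n \<Delta> =
     (norm_length \<rho> n \<Delta>, neighbour_set m \<rho> d n \<Delta>, net_position m \<rho> d K n \<Delta>)"

definition char_vectors :: "nat \<Rightarrow> real \<Rightarrow> (nat \<Rightarrow> real) \<Rightarrow> real set \<Rightarrow> char_vec set" where
  "char_vectors m \<rho> d K =
     {char_vector m \<rho> d K n \<Delta> | n \<Delta>. \<Delta> \<in> net_intervals m \<rho> d K n}"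

definition char_child ::
  "nat \<Rightarrow> real \<Rightarrow> (nat \<Rightarrow> real) \<Rightarrow> real set \<Rightarrow> char_vec \<Rightarrow> char_vec \<Rightarrow> bool" where
  "char_child m \<rho> d K \<alpha> \<beta> \<longleftrightarrow>
     (\<exists>n \<Delta>' \<Delta>. net_child m \<rho> d K n \<Delta>' \<Delta> \<and>
        \<alpha> = char_vector m \<rho> d K n \<Delta>' \<and> \<beta> = char_vector m \<rho> d K (Suc n) \<Delta>)"


section \<open>Essential class and truly essential points\<close>

definition admissible_path ::
  "nat \<Rightarrow> real \<Rightarrow> (nat \<Rightarrow> real) \<Rightarrow> real set \<Rightarrow> char_vec list \<Rightarrow> bool" where
  "admissible_path m \<rho> d K \<gamma> \<longleftrightarrow>
     \<gamma> \<noteq> [] \<and> set \<gamma> \<subseteq> char_vectors m \<rho> d K \<and> successively (char_child m \<rho> d K) \<gamma>"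

definition loop_class ::
  "nat \<Rightarrow> real \<Rightarrow> (nat \<Rightarrow> real) \<Rightarrow> real set \<Rightarrow> char_vec set \<Rightarrow> bool" where
  "loop_class m \<rho> d K E \<longleftrightarrow>
     E \<noteq> {} \<and> E \<subseteq> char_vectors m \<rho> d K \<and>
     (\<forall>\<alpha>\<in>E. \<forall>\<beta>\<in>E. \<exists>\<gamma>. admissible_path m \<rho> d K \<gamma> \<and> set \<gamma> \<subseteq> E \<and> hd \<gamma> = \<alpha> \<and> last \<gamma> = \<beta>)"

definition essential_class ::
  "nat \<Rightarrow> real \<Rightarrow> (nat \<Rightarrow> real) \<Rightarrow> real set \<Rightarrow> char_vec set \<Rightarrow> bool" where
  "essential_class m \<rho> d K E \<longleftrightarrow>
     loop_class m \<rho> d K E \<and> (\<forall>\<alpha>\<in>E. \<forall>\<beta>. char_child m \<rho> d K \<alpha> \<beta> \<longrightarrow> \<beta> \<in> E)"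

text \<open>Under finite type there is exactly one essential class, so lying in an essential class
  means lying in the essential class.\<close>

definition essential_interval ::
  "nat \<Rightarrow> real \<Rightarrow> (nat \<Rightarrow> real) \<Rightarrow> real set \<Rightarrow> nat \<Rightarrow> real set \<Rightarrow> bool" where
  "essential_interval m \<rho> d K n \<Delta> \<longleftrightarrow>
     \<Delta> \<in> net_intervals m \<rho> d K n \<and>
     (\<exists>E. essential_class m \<rho> d K E \<and> char_vector m \<rho> d K n \<Delta> \<in> E)"

definition boundary_point ::
  "nat \<Rightarrow> real \<Rightarrow> (nat \<Rightarrow> real) \<Rightarrow> real set \<Rightarrow> real \<Rightarrow> bool" where
  "boundary_point m \<rho> d K x \<longleftrightarrow>
     x \<in> K \<and> (\<exists>n. \<exists>\<Delta>\<in>net_intervals m \<rho> d K n. x = Inf \<Delta> \<or> x = Sup \<Delta>)"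

definition other_net_interval ::
  "nat \<Rightarrow> real \<Rightarrow> (nat \<Rightarrow> real) \<Rightarrow> real set \<Rightarrow> nat \<Rightarrow> real \<Rightarrow> real set \<Rightarrow> real set \<Rightarrow> bool" where
  "other_net_interval m \<rho> d K n x \<Delta> \<Delta>' \<longleftrightarrow>
     \<Delta>' \<in> net_intervals m \<rho> d K n \<and>
     (x = Inf \<Delta> \<and> x = Sup \<Delta>' \<or> x = Sup \<Delta> \<and> x = Inf \<Delta>')"

text \<open>There is at most one other net interval; the universal quantifier makes its absence count
  as essential.\<close>

definition boundary_essential ::
  "nat \<Rightarrow> real \<Rightarrow> (nat \<Rightarrow> real) \<Rightarrow> real set \<Rightarrow> real \<Rightarrow> bool" where
  "boundary_essential m \<rho> d K x \<longleftrightarrow>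
     x \<in> K \<and>
     (\<exists>n \<Delta>. essential_interval m \<rho> d K n \<Delta> \<and> (x = Inf \<Delta> \<or> x = Sup \<Delta>) \<and>
        (\<forall>\<Delta>'. other_net_interval m \<rho> d K n x \<Delta> \<Delta>' \<longrightarrow> essential_interval m \<rho> d K n \<Delta>'))"

definition interior_essential ::
  "nat \<Rightarrow> real \<Rightarrow> (nat \<Rightarrow> real) \<Rightarrow> real set \<Rightarrow> real \<Rightarrow> bool" where
  "interior_essential m \<rho> d K x \<longleftrightarrow>
     x \<in> K \<and> \<not> boundary_point m \<rho> d K x \<and>
     (\<exists>n \<Delta>. essential_interval m \<rho> d K n \<Delta> \<and> x \<in> interior \<Delta>)"

definition truly_essential ::
  "nat \<Rightarrow> real \<Rightarrow> (nat \<Rightarrow> real) \<Rightarrow> real set \<Rightarrow> real \<Rightarrow> bool" where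
  "truly_essential m \<rho> d K x \<longleftrightarrow>
     boundary_essential m \<rho> d K x \<or> interior_essential m \<rho> d K x"


section \<open>Hausdorff measure and dimension\<close>

text \<open>The summand \<open>diam\<^sup>s\<close>, with the usual conventions \<open>diam(\<emptyset>)\<^sup>s = 0\<close> and \<open>0\<^sup>0 = 1\<close> for
  non-empty sets; note that \<open>0 powr 0 = 0\<close>.\<close>

definition diam_powr :: "real \<Rightarrow> 'a::metric_space set \<Rightarrow> ennreal" where
  "diam_powr s U = (if U = {} then 0 else if s = 0 then 1 else ennreal (diameter U powr s))"

definition hausdorff_pre :: "real \<Rightarrow> real \<Rightarrow> 'a::metric_space set \<Rightarrow> ennreal" where
  "hausdorff_pre s \<delta> A =
     (INF U \<in> {U :: nat \<Rightarrow> 'a set. A \<subseteq> (\<Union>i. U i) \<and> (\<forall>i. bounded (U i) \<and> diameter (U i) \<le> \<delta>)}.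
        \<Sum>i. diam_powr s (U i))"

text \<open>The Hausdorff outer measure, defined on all sets; on Borel sets it is the Hausdorff measure.\<close>

definition hausdorff_measure :: "real \<Rightarrow> 'a::metric_space set \<Rightarrow> ennreal" where
  "hausdorff_measure s A = (SUP \<delta>\<in>{0<..}. hausdorff_pre s \<delta> A)"

definition hausdorff_dim :: "'a::euclidean_space set \<Rightarrow> real" where
  "hausdorff_dim A = Inf {s. 0 \<le> s \<and> hausdorff_measure s A = 0}"

text \<open>Hausdorff measure restricted to \<open>K\<close> and normalized to give \<open>K\<close> mass \<open>1\<close>. This requires
  \<open>0 < hausdorff_measure s K < \<infinity>\<close>, which holds for the attractor of a finite type IFS
  when \<open>s\<close> is its dimension.\<close>

definition normalized_hausdorff :: "'a::metric_space set \<Rightarrow> real \<Rightarrow> 'a set \<Rightarrow> ennreal" where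
  "normalized_hausdorff K s A = hausdorff_measure s (A \<inter> K) / hausdorff_measure s K"

end

theory Submission
  imports Defs
begin

text \<open>Take a net interval \<open>\<Delta>\<close> whose neighbour set has maximal cardinality. An endpoint of a
  later generation inside \<open>S\<^sub>\<omega>(\<Delta>)\<close> would produce a net interval with one more
  neighbour, so every \<open>S\<^sub>\<omega>(\<Delta>)\<close> is again a net interval with the same normalized length
  and neighbour set. Descending from \<open>\<Delta>\<close> to the essential class gives an open interval \<open>G\<close>
  meeting \<open>K\<close> such that all \<open>S\<^sub>\<omega>(G)\<close> are interiors of essential net intervals, and the
  closed set is \<open>C = K - (\<Union>\<omega>. S\<^sub>\<omega>(G))\<close>.

  It is null for \<open>\<mu>\<close> because \<open>\<mu>(S\<^sub>\<omega>\<^sup>-\<^sup>1 C) = \<mu>(C)\<close> for every word while \<open>S\<^sub>\<tau>\<^sup>-\<^sup>1 C\<close> misses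
  \<open>K\<close> as soon as \<open>S\<^sub>\<tau>(K) \<subseteq> G\<close>. For the Hausdorff measure, every piece \<open>S\<^sub>\<sigma>(K)\<close> contains a hole
  \<open>S\<^sub>\<sigma>(S\<^sub>\<tau>(K))\<close> of \<open>C\<close>; by finite type a fixed proportion of any union of pieces of one level
  lies in disjoint pieces, so passing to smaller pieces that still meet \<open>C\<close> loses a fixed proportion
  of the measure.\<close>

section \<open>Hausdorff measure\<close>

text \<open>The obstacle is the position entry: it depends on the siblings of an interval, so a copy
  of \<open>\<Delta>\<close> with the same normalized length and neighbour set may still have
  another characteristic vector, while the essential class is a set of full vectors. Length and
  neighbour set do, however, determine all children together with their positions. Hence one further
  generation fixes the whole vector in all copies at once, and the descent can follow characteristic
  vectors instead of actual intervals, since being reproduced by every \<open>S \<omega>\<close>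
  passes to children. A maximal neighbour set exists because finite type bounds the number of
  neighbours. Hausdorff measure is treated as an outer measure: it is subadditive, scales under
  affine maps, and adds up over disjoint compact sets. Since pieces overlap, the pieces of a level
  are counted by their positions rather than by words.\<close>

lemma INF_add_INF_greatest:
  fixes f :: "'a \<Rightarrow> ennreal" and g :: "'b \<Rightarrow> ennreal"
  assumes "\<And>x y. x \<in> I \<Longrightarrow> y \<in> J \<Longrightarrow> c \<le> f x + g y"
  shows "c \<le> (INF x\<in>I. f x) + (INF y\<in>J. g y)"
proof (rule ennreal_le_epsilon)
  fix e :: real
  assume fin: "(INF x\<in>I. f x) + (INF y\<in>J. g y) < top" and e: "0 < e"
  have less: "a < a + ennreal (e/2)" if "a < top" for a
    using that e by (cases a) (auto simp flip: ennreal_plus intro!: ennreal_lessI)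
  from fin have "(INF x\<in>I. f x) < top" "(INF y\<in>J. g y) < top"
    by (auto simp: ennreal_add_less_top)
  with less obtain x y where "x \<in> I" "f x < (INF x\<in>I. f x) + ennreal (e/2)"
    "y \<in> J" "g y < (INF y\<in>J. g y) + ennreal (e/2)"
    by (metis (no_types, lifting) INF_less_iff)
  then have "c \<le> ((INF x\<in>I. f x) + ennreal (e/2)) + ((INF y\<in>J. g y) + ennreal (e/2))"
    by (intro order_trans[OF assms add_mono] less_imp_le)
  also have "\<dots> = (INF x\<in>I. f x) + (INF y\<in>J. g y) + (ennreal (e/2) + ennreal (e/2))"
    by (simp only: ac_simps)
  also have "ennreal (e/2) + ennreal (e/2) = ennreal e"
    using e by (simp flip: ennreal_plus)
  finally show "c \<le> (INF x\<in>I. f x) + (INF y\<in>J. g y) + ennreal e" .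
qed

text \<open>Covers are sequences, so covers of two sets are merged by alternating them; this bounds
  the cost of the merged cover.\<close>

lemma suminf_interleave_le:
  fixes f g :: "nat \<Rightarrow> ennreal"
  shows "(\<Sum>i. if even i then f (i div 2) else g (i div 2)) \<le> suminf f + suminf g"
proof (rule suminf_le_const[OF summableI])
  fix n
  let ?h = "\<lambda>i. if even i then f (i div 2) else g (i div 2)"
  have eq: "sum ?h {..<2*n} = sum f {..<n} + sum g {..<n}" for n
    by (induction n) (auto simp: ac_simps)
  have "sum ?h {..<n} \<le> sum ?h {..<2*n}"
    by (rule sum_mono2) auto
  also have "\<dots> \<le> suminf f + suminf g"
    unfolding eq by (intro add_mono sum_le_suminf) auto
  finally show "sum ?h {..<n} \<le> suminf f + suminf g" .
qed

lemma diam_powr_empty [simp]: "diam_powr s {} = 0"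
  by (simp add: diam_powr_def)

lemma hausdorff_pre_lower:
  assumes "A \<subseteq> (\<Union>i. U i)" "\<And>i. bounded (U i)" "\<And>i. diameter (U i) \<le> \<delta>"
  shows "hausdorff_pre s \<delta> A \<le> (\<Sum>i. diam_powr s (U i))"
  unfolding hausdorff_pre_def using assms by (intro INF_lower) auto

lemma hausdorff_pre_antimono:
  assumes "A \<subseteq> B" "\<delta> \<le> \<epsilon>"
  shows "hausdorff_pre s \<epsilon> A \<le> hausdorff_pre s \<delta> B"
  unfolding hausdorff_pre_def using assms by (intro INF_superset_mono) (auto intro: order_trans)

lemma hausdorff_pre_le_measure: "0 < \<delta> \<Longrightarrow> hausdorff_pre s \<delta> A \<le> hausdorff_measure s A"
  unfolding hausdorff_measure_def by (rule SUP_upper) simp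

lemma hausdorff_measure_mono: "A \<subseteq> B \<Longrightarrow> hausdorff_measure s A \<le> hausdorff_measure s B"
  unfolding hausdorff_measure_def by (intro SUP_mono') (auto intro: hausdorff_pre_antimono)

lemma hausdorff_measure_empty [simp]: "hausdorff_measure s {} = 0"
proof -
  have "hausdorff_pre s \<delta> ({}::'a set) = 0" if "\<delta> > 0" for \<delta>
    using hausdorff_pre_lower[of "{}::'a set" "\<lambda>_. {}" \<delta> s] that by simp
  then show ?thesis
    by (simp add: hausdorff_measure_def SUP_eq_iff)
qed

lemma hausdorff_pre_Un_le:
  "hausdorff_pre s \<delta> (A \<union> B) \<le> hausdorff_pre s \<delta> A + hausdorff_pre s \<delta> B"
  unfolding hausdorff_pre_def[of s \<delta> A] hausdorff_pre_def[of s \<delta> B]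
proof (rule INF_add_INF_greatest, clarify)
  fix U V :: "nat \<Rightarrow> 'a set"
  assume U: "A \<subseteq> (\<Union>i. U i)" "\<forall>i. bounded (U i) \<and> diameter (U i) \<le> \<delta>"
    and V: "B \<subseteq> (\<Union>i. V i)" "\<forall>i. bounded (V i) \<and> diameter (V i) \<le> \<delta>"
  define W where "W i = (if even i then U (i div 2) else V (i div 2))" for i :: nat
  have "U i = W (2*i)" "V i = W (2*i+1)" for i
    by (simp_all add: W_def)
  then have "(\<Union>i. U i) \<subseteq> (\<Union>i. W i)" "(\<Union>i. V i) \<subseteq> (\<Union>i. W i)"
    by auto
  then have "A \<union> B \<subseteq> (\<Union>i. W i)"
    using U(1) V(1) by (intro Un_least) (rule order_trans, assumption, assumption)+
  then have "hausdorff_pre s \<delta> (A \<union> B) \<le> (\<Sum>i. diam_powr s (W i))"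
    using U(2) V(2) by (intro hausdorff_pre_lower) (auto simp: W_def)
  also have "\<dots> = (\<Sum>i. if even i then diam_powr s (U (i div 2)) else diam_powr s (V (i div 2)))"
    by (intro suminf_cong) (auto simp: W_def)
  also have "\<dots> \<le> (\<Sum>i. diam_powr s (U i)) + (\<Sum>i. diam_powr s (V i))"
    by (rule suminf_interleave_le)
  finally show "hausdorff_pre s \<delta> (A \<union> B) \<le> (\<Sum>i. diam_powr s (U i)) + (\<Sum>i. diam_powr s (V i))" .
qed

lemma hausdorff_measure_Un_le:
  "hausdorff_measure s (A \<union> B) \<le> hausdorff_measure s A + hausdorff_measure s B"
  unfolding hausdorff_measure_def[of s "A \<union> B"]
  by (intro SUP_least order_trans[OF hausdorff_pre_Un_le] add_mono hausdorff_pre_le_measure) auto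

lemma hausdorff_measure_UN_le:
  assumes "finite I"
  shows "hausdorff_measure s (\<Union>i\<in>I. A i) \<le> (\<Sum>i\<in>I. hausdorff_measure s (A i))"
  using assms
  by induction (auto intro: order_trans[OF hausdorff_measure_Un_le] add_left_mono)

text \<open>A set of diameter below \<open>\<epsilon>\<close> cannot meet both parts, so a fine
  cover of the union splits into covers of \<open>A\<close> and of \<open>B\<close> that share no
  member.\<close>

lemma hausdorff_measure_Un_separated:
  fixes A B :: "'a::metric_space set"
  assumes "0 < \<epsilon>" and sep: "\<And>x y. x \<in> A \<Longrightarrow> y \<in> B \<Longrightarrow> \<epsilon> \<le> dist x y"
  shows "hausdorff_measure s (A \<union> B) = hausdorff_measure s A + hausdorff_measure s B"
proof (rule antisym[OF hausdorff_measure_Un_le])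
  have pre: "hausdorff_pre s \<delta> A + hausdorff_pre s \<delta> B \<le> hausdorff_pre s \<delta> (A \<union> B)"
    if "\<delta> < \<epsilon>" "0 < \<delta>" for \<delta>
    unfolding hausdorff_pre_def[of s \<delta> "A \<union> B"]
  proof (rule INF_greatest, clarify)
    fix U :: "nat \<Rightarrow> 'a set"
    assume U: "A \<union> B \<subseteq> (\<Union>i. U i)" "\<forall>i. bounded (U i) \<and> diameter (U i) \<le> \<delta>"
    \<comment> \<open>Members that miss the set are replaced by the empty set, whose cost is 0, so
      the index set stays the same.\<close>
    let ?V = "\<lambda>A i. if U i \<inter> A = {} then {} else U i"
    have excl: "U i \<inter> A = {} \<or> U i \<inter> B = {}" for i
    proof (rule ccontr)
      assume "\<not> ?thesis"
      then obtain x y where "x \<in> U i" "x \<in> A" "y \<in> U i" "y \<in> B" by auto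
      moreover from this have "dist x y \<le> \<delta>"
        using U(2) diameter_bounded_bound order_trans by blast
      ultimately show False
        using sep[of x y] \<open>\<delta> < \<epsilon>\<close> by simp
    qed
    have le: "hausdorff_pre s \<delta> S \<le> (\<Sum>i. diam_powr s (?V S i))" if "S \<subseteq> A \<union> B" for S
      using U that \<open>0 < \<delta>\<close> by (intro hausdorff_pre_lower) (auto, blast)
    have "hausdorff_pre s \<delta> A + hausdorff_pre s \<delta> B
        \<le> (\<Sum>i. diam_powr s (?V A i)) + (\<Sum>i. diam_powr s (?V B i))"
      by (intro add_mono le) auto
    also have "\<dots> = (\<Sum>i. diam_powr s (?V A i) + diam_powr s (?V B i))"
      by (intro suminf_add summableI)
    also have "\<dots> \<le> (\<Sum>i. diam_powr s (U i))"
      using excl by (intro suminf_le summableI) auto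
    finally show "hausdorff_pre s \<delta> A + hausdorff_pre s \<delta> B \<le> (\<Sum>i. diam_powr s (U i))" .
  qed
  have "hausdorff_pre s \<delta> A + hausdorff_pre s \<delta>' B \<le> hausdorff_measure s (A \<union> B)"
    if "0 < \<delta>" "0 < \<delta>'" for \<delta> \<delta>'
  proof -
    \<comment> \<open>The two suprema run over independent meshes. The premeasure grows as the mesh
      shrinks, so a common mesh below \<open>\<epsilon>\<close> serves both.\<close>
    let ?m = "min (min \<delta> \<delta>') (\<epsilon>/2)"
    have "hausdorff_pre s \<delta> A + hausdorff_pre s \<delta>' B \<le> hausdorff_pre s ?m A + hausdorff_pre s ?m B"
      by (intro add_mono hausdorff_pre_antimono) auto
    also have "\<dots> \<le> hausdorff_pre s ?m (A \<union> B)"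
      using that assms by (intro pre) auto
    also have "\<dots> \<le> hausdorff_measure s (A \<union> B)"
      using that assms by (intro hausdorff_pre_le_measure) auto
    finally show ?thesis .
  qed
  then show "hausdorff_measure s A + hausdorff_measure s B \<le> hausdorff_measure s (A \<union> B)"
    unfolding hausdorff_measure_def[of s A] hausdorff_measure_def[of s B]
    by (simp flip: ennreal_SUP_add_left add: ennreal_SUP_add_right SUP_le_iff)
qed

text \<open>Compactness gives a positive distance between the two sets, hence additivity directly
  for the outer measure.\<close>

lemma hausdorff_measure_Un_compact:
  fixes A B :: "'a::heine_borel set"
  assumes "compact A" "compact B" "A \<inter> B = {}"
  shows "hausdorff_measure s (A \<union> B) = hausdorff_measure s A + hausdorff_measure s B"
proof -
  obtain \<epsilon> where "\<epsilon> > 0" "\<forall>x\<in>A. \<forall>y\<in>B. \<epsilon> \<le> dist x y"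
    using separate_compact_closed[of A B] assms compact_imp_closed by blast
  then show ?thesis
    by (intro hausdorff_measure_Un_separated) auto
qed

lemma hausdorff_measure_UN_compact:
  fixes A :: "'i \<Rightarrow> 'a::heine_borel set"
  assumes "finite I" "\<And>i. i \<in> I \<Longrightarrow> compact (A i)" "disjoint_family_on A I"
  shows "hausdorff_measure s (\<Union>i\<in>I. A i) = (\<Sum>i\<in>I. hausdorff_measure s (A i))"
  using assms
proof induction
  case (insert i I)
  have "A i \<inter> (\<Union>i\<in>I. A i) = {}"
    using insert.prems(2) insert.hyps(2) by (auto simp: disjoint_family_on_def)
  then show ?case
    using insert by (simp add: hausdorff_measure_Un_compact compact_UN disjoint_family_on_insert)
qed simp

section \<open>Scaling under affine maps\<close>

lemma bounded_affine:
  fixes U :: "real set"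
  assumes "bounded U"
  shows "bounded ((\<lambda>x. p + r * x) ` U)"
  using bounded_translation[OF bounded_linear_image[OF assms bounded_linear_mult_right[of r]], of p]
  by (simp add: image_image)

lemma diameter_affine_le:
  fixes U :: "real set"
  assumes "bounded U" "0 < r"
  shows "diameter ((\<lambda>x. p + r * x) ` U) \<le> r * diameter U"
proof (cases "U = {}")
  case False
  show ?thesis
  proof (rule diameter_le)
    fix x y assume "x \<in> (\<lambda>x. p + r * x) ` U" "y \<in> (\<lambda>x. p + r * x) ` U"
    then obtain u v where uv: "u \<in> U" "v \<in> U" "x = p + r * u" "y = p + r * v" by auto
    have "dist u v \<le> diameter U"
      using assms uv diameter_bounded_bound by blast
    moreover have "norm (x - y) = r * dist u v"
      using assms uv by (simp add: dist_norm abs_mult flip: right_diff_distrib)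
    ultimately show "norm (x - y) \<le> r * diameter U"
      using assms by simp
  qed (use False in simp)
qed simp

lemma diameter_affine:
  fixes U :: "real set"
  assumes "bounded U" "0 < r"
  shows "diameter ((\<lambda>x. p + r * x) ` U) = r * diameter U"
proof (rule antisym[OF diameter_affine_le[OF assms]])
  let ?V = "(\<lambda>x. p + r * x) ` U"
  have "bounded ?V"
    using assms(1) by (rule bounded_affine)
  \<comment> \<open>The reverse inequality is the first one applied to the inverse affine
    map.\<close>
  then have "diameter ((\<lambda>x. - p / r + 1 / r * x) ` ?V) \<le> 1 / r * diameter ?V"
    using assms by (intro diameter_affine_le) auto
  also have "(\<lambda>x. - p / r + 1 / r * x) ` ?V = U"
    using assms by (force simp: image_image field_simps)
  finally show "r * diameter U \<le> diameter ?V"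
    using assms by (simp add: field_simps)
qed

lemma diam_powr_affine:
  fixes U :: "real set"
  assumes "bounded U" "0 < r"
  shows "diam_powr s ((\<lambda>x. p + r * x) ` U) = ennreal (r powr s) * diam_powr s U"
  using assms diameter_ge_0[of U]
  by (auto simp: diam_powr_def diameter_affine powr_mult simp flip: ennreal_mult)

lemma hausdorff_measure_affine_le:
  fixes A :: "real set"
  assumes "0 < r"
  shows "hausdorff_measure s ((\<lambda>x. p + r * x) ` A) \<le> ennreal (r powr s) * hausdorff_measure s A"
proof -
  \<comment> \<open>Both factors are finite and nonzero, so in \<open>ennreal\<close> either can be
    moved across an inequality by multiplying with the other.\<close>
  let ?f = "\<lambda>x. p + r * x" and ?c = "ennreal (r powr s)" and ?c' = "ennreal (1 / (r powr s))"
  have cancel: "?c * (?c' * x) = x" "?c' * (?c * x) = x" for x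
    using assms by (simp_all flip: mult.assoc ennreal_mult)
  have "hausdorff_pre s \<delta> (?f ` A) \<le> ?c * hausdorff_measure s A" if "0 < \<delta>" for \<delta>
  proof -
    have "?c' * hausdorff_pre s \<delta> (?f ` A) \<le> hausdorff_pre s (\<delta> / r) A"
      unfolding hausdorff_pre_def[of s "\<delta> / r" A]
    proof (rule INF_greatest, clarify)
      fix U :: "nat \<Rightarrow> real set"
      assume U: "A \<subseteq> (\<Union>i. U i)" "\<forall>i. bounded (U i) \<and> diameter (U i) \<le> \<delta> / r"
      have "hausdorff_pre s \<delta> (?f ` A) \<le> (\<Sum>i. diam_powr s (?f ` U i))"
      proof (rule hausdorff_pre_lower)
        show "bounded (?f ` U i)" for i
          using U(2) by (intro bounded_affine) auto
        show "diameter (?f ` U i) \<le> \<delta>" for i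
        proof -
          have "r * diameter (U i) \<le> \<delta>"
            using U(2) assms by (simp add: field_simps)
          then show ?thesis
            using U(2) assms by (simp add: diameter_affine)
        qed
      qed (use U(1) in blast)
      also have "\<dots> = ?c * (\<Sum>i. diam_powr s (U i))"
        using U assms by (simp add: diam_powr_affine)
      finally have "?c' * hausdorff_pre s \<delta> (?f ` A) \<le> ?c' * (?c * (\<Sum>i. diam_powr s (U i)))"
        by (intro mult_left_mono) auto
      then show "?c' * hausdorff_pre s \<delta> (?f ` A) \<le> (\<Sum>i. diam_powr s (U i))"
        by (simp only: cancel)
    qed
    also have "\<dots> \<le> hausdorff_measure s A"
      using assms that by (intro hausdorff_pre_le_measure) auto
    finally have "?c * (?c' * hausdorff_pre s \<delta> (?f ` A)) \<le> ?c * hausdorff_measure s A"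
      by (intro mult_left_mono) auto
    then show ?thesis
      by (simp only: cancel)
  qed
  then show ?thesis
    unfolding hausdorff_measure_def[of s "?f ` A"] by (intro SUP_least) auto
qed

lemma hausdorff_measure_affine:
  fixes A :: "real set"
  assumes "0 < r"
  shows "hausdorff_measure s ((\<lambda>x. p + r * x) ` A) = ennreal (r powr s) * hausdorff_measure s A"
proof (rule antisym[OF hausdorff_measure_affine_le[OF assms]])
  let ?V = "(\<lambda>x. p + r * x) ` A"
  have "(\<lambda>x. - p / r + 1 / r * x) ` ?V = A"
    using assms by (force simp: image_image field_simps)
  then have "hausdorff_measure s A \<le> ennreal ((1 / r) powr s) * hausdorff_measure s ?V"
    using hausdorff_measure_affine_le[of "1 / r" s "- p / r" ?V] assms by simp
  then have "ennreal (r powr s) * hausdorff_measure s A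
      \<le> ennreal (r powr s) * (ennreal ((1 / r) powr s) * hausdorff_measure s ?V)"
    by (intro mult_left_mono) auto
  also have "\<dots> = hausdorff_measure s ?V"
    using assms by (simp add: powr_divide flip: mult.assoc ennreal_mult)
  finally show "ennreal (r powr s) * hausdorff_measure s A \<le> hausdorff_measure s ?V" .
qed

text \<open>Greedy choice: a point joins \<open>P0\<close> when no chosen point lies within
  \<open>r\<close>. With \<open>r\<close> the length of a piece and \<open>P\<close> the left ends,
  chosen pieces are disjoint and every piece lies close to a chosen one.\<close>

lemma maximal_separated_subset:
  fixes P :: "real set"
  assumes "finite P"
    and "0 \<le> r"
  obtains P0 where "P0 \<subseteq> P" "\<And>p q. p \<in> P0 \<Longrightarrow> q \<in> P0 \<Longrightarrow> p \<noteq> q \<Longrightarrow> r < \<bar>p - q\<bar>"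
    "\<And>p. p \<in> P \<Longrightarrow> \<exists>q\<in>P0. \<bar>p - q\<bar> \<le> r"
proof -
  have "\<exists>P0\<subseteq>P. (\<forall>p\<in>P0. \<forall>q\<in>P0. p \<noteq> q \<longrightarrow> r < \<bar>p - q\<bar>) \<and> (\<forall>p\<in>P. \<exists>q\<in>P0. \<bar>p - q\<bar> \<le> r)"
    using assms(1)
  proof induction
    case (insert x P)
    then obtain P0 where P0: "P0 \<subseteq> P" "\<forall>p\<in>P0. \<forall>q\<in>P0. p \<noteq> q \<longrightarrow> r < \<bar>p - q\<bar>"
        "\<forall>p\<in>P. \<exists>q\<in>P0. \<bar>p - q\<bar> \<le> r"
      by blast
    show ?case
    proof (cases "\<exists>q\<in>P0. \<bar>x - q\<bar> \<le> r")
      case True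
      with P0 show ?thesis
        by (intro exI[of _ P0]) auto
    next
      case False
      with P0 \<open>0 \<le> r\<close> show ?thesis
        by (intro exI[of _ "insert x P0"]) (auto simp: not_le abs_minus_commute)
    qed
  qed simp
  with that show ?thesis by metis
qed

section \<open>Net intervals\<close>

locale ifs =
  fixes m :: nat and \<rho> :: real and d :: "nat \<Rightarrow> real" and K :: "real set"
  assumes m_pos: "m \<ge> 1" and \<rho>_pos: "0 < \<rho>" and \<rho>_less: "\<rho> < 1" and d_0: "d 0 = 0"
    and d_mono: "strict_mono_on {..m} d"
    and attractor: "is_attractor m \<rho> d K" and hull: "convex hull K = {0..1}"
begin

abbreviation S :: "nat list \<Rightarrow> real \<Rightarrow> real" where "S \<equiv> word_map \<rho> d"
abbreviation W :: "nat \<Rightarrow> nat list set" where "W \<equiv> words m"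
abbreviation pts :: "nat \<Rightarrow> real set" where "pts \<equiv> net_points m \<rho> d"

section \<open>Normalization, words and pieces\<close>

lemma \<rho>_neq_0 [simp]: "\<rho> \<noteq> 0"
  using \<rho>_pos by simp

lemma compact_K: "compact K" and K_nonempty: "K \<noteq> {}"
  using attractor by (auto simp: is_attractor_def)

lemma K_eq: "K = (\<Union>j\<le>m. ifs_map \<rho> d j ` K)"
  using attractor by (auto simp: is_attractor_def)

lemma K_subset: "K \<subseteq> {0..1}"
  using hull hull_subset[of K convex] by simp

text \<open>Without 0, \<open>K\<close> would lie in the half-open interval, which is convex, and so
  would its hull.\<close>

lemma zero_in_K: "0 \<in> K"
proof (rule ccontr)
  assume "0 \<notin> K"
  then have "K \<subseteq> {0<..1}"
    using K_subset by (force simp: less_le)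
  then have "convex hull K \<subseteq> {0<..1}"
    by (intro hull_minimal) auto
  then have "0 \<in> {0<..1::real}"
    using hull by (auto simp del: greaterThanAtMost_iff)
  then show False
    by simp
qed

lemma one_in_K: "1 \<in> K"
proof (rule ccontr)
  assume "1 \<notin> K"
  then have "K \<subseteq> {0..<1}"
    using K_subset by (force simp: less_le)
  then have "convex hull K \<subseteq> {0..<1}"
    by (intro hull_minimal) auto
  then have "1 \<in> {0..<1::real}"
    using hull by (auto simp del: atLeastLessThan_iff)
  then show False
    by simp
qed

lemma ifs_map_in_K: "x \<in> K \<Longrightarrow> j \<le> m \<Longrightarrow> ifs_map \<rho> d j x \<in> K"
  using K_eq by blast

text \<open>The point 1 lies in some piece, and no piece reaches further right than the last one. So
  the last map fixes 1, just as \<open>d 0 = 0\<close> makes the first map fix 0.\<close>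

lemma d_last: "d m = 1 - \<rho>"
proof -
  obtain y j where y: "y \<in> K" "j \<le> m" "1 = ifs_map \<rho> d j y"
    using K_eq one_in_K by blast
  have "d j \<le> d m"
    using strict_mono_on_leD[OF d_mono] y(2) by simp
  moreover have "\<rho> * y \<le> \<rho>"
    using y(1) K_subset \<rho>_pos by (auto intro: mult_left_le)
  ultimately have "1 \<le> \<rho> + d m"
    using y(3) by (simp add: ifs_map_def)
  moreover have "\<rho> + d m \<le> 1"
    using ifs_map_in_K[OF one_in_K, of m] K_subset by (auto simp: ifs_map_def)
  ultimately show ?thesis by simp
qed

lemma \<rho>_in_K: "\<rho> \<in> K"
  using ifs_map_in_K[OF one_in_K, of 0] by (simp add: ifs_map_def d_0)

text \<open>Iterating the first map on 1 gives points of \<open>K\<close> that accumulate at 0; the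
  next lemma does the same at 1. They provide points of \<open>K\<close> arbitrarily close to either
  end of a piece.\<close>

lemma power_in_K: "\<rho> ^ n \<in> K"
proof (induction n)
  case (Suc n)
  then show ?case
    using ifs_map_in_K[of "\<rho> ^ n" 0] by (simp add: ifs_map_def d_0)
qed (simp add: one_in_K)

lemma one_minus_power_in_K: "1 - \<rho> ^ n \<in> K"
proof (induction n)
  case (Suc n)
  then show ?case
    using ifs_map_in_K[of "1 - \<rho> ^ n" m] by (simp add: ifs_map_def d_last algebra_simps)
qed (simp add: zero_in_K)

lemma S_eq: "S \<sigma> x = S \<sigma> 0 + \<rho> ^ length \<sigma> * x"
proof (induction \<sigma> arbitrary: x)
  case (Cons j \<sigma>)
  show ?case
    unfolding word_map.simps comp_def ifs_map_def by (subst Cons) (simp add: algebra_simps)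
qed simp

lemma S_words: "\<sigma> \<in> W n \<Longrightarrow> S \<sigma> x = S \<sigma> 0 + \<rho> ^ n * x"
  by (subst S_eq) (simp add: words_def)

lemma S_append: "S (\<sigma> @ \<tau>) x = S \<sigma> (S \<tau> x)"
  by (induction \<sigma>) auto

lemma S_append_0: "\<sigma> \<in> W n \<Longrightarrow> S (\<sigma> @ \<tau>) 0 = S \<sigma> 0 + \<rho> ^ n * S \<tau> 0"
  by (metis S_append S_words)

lemma words_append: "\<sigma> \<in> W n \<Longrightarrow> \<tau> \<in> W k \<Longrightarrow> \<sigma> @ \<tau> \<in> W (n + k)"
  by (auto simp: words_def)

lemma words_0 [simp]: "W 0 = {[]}"
  by (auto simp: words_def)

lemma words_snoc: "\<sigma> \<in> W n \<Longrightarrow> j \<le> m \<Longrightarrow> \<sigma> @ [j] \<in> W (Suc n)"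
  by (auto simp: words_def)

lemma words_add_cases:
  assumes "\<sigma> \<in> W (n + k)"
  obtains \<sigma>1 \<sigma>2 where "\<sigma> = \<sigma>1 @ \<sigma>2" "\<sigma>1 \<in> W n" "\<sigma>2 \<in> W k"
proof
  show "\<sigma> = take n \<sigma> @ drop n \<sigma>" by simp
qed (use assms in \<open>auto simp: words_def dest: in_set_takeD in_set_dropD\<close>)

lemma words_Suc_cases:
  assumes "\<sigma> \<in> W (Suc n)"
  obtains \<sigma>' j where "\<sigma> = \<sigma>' @ [j]" "\<sigma>' \<in> W n" "j \<le> m"
proof -
  have "\<sigma> \<in> W (n + 1)"
    using assms by simp
  then obtain \<sigma>1 \<sigma>2 where *: "\<sigma> = \<sigma>1 @ \<sigma>2" "\<sigma>1 \<in> W n" "\<sigma>2 \<in> W 1"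
    by (rule words_add_cases)
  then obtain j where "\<sigma>2 = [j]" "j \<le> m"
    by (auto simp: words_def length_Suc_conv)
  with * that show ?thesis by blast
qed

lemma S_snoc_0: "\<sigma> \<in> W n \<Longrightarrow> S (\<sigma> @ [j]) 0 = S \<sigma> 0 + \<rho> ^ n * d j"
  using S_append_0[of \<sigma> n "[j]"] by (simp add: ifs_map_def)

lemma finite_words: "finite (W n)"
proof -
  have "W n = {\<sigma>. set \<sigma> \<subseteq> {..m} \<and> length \<sigma> = n}"
    by (auto simp: words_def)
  then show ?thesis
    by (simp add: finite_lists_length_eq)
qed

lemma S_in_K: "\<sigma> \<in> W n \<Longrightarrow> x \<in> K \<Longrightarrow> S \<sigma> x \<in> K"
proof (induction \<sigma> arbitrary: n)
  case (Cons j \<sigma>)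
  then have "\<sigma> \<in> W (length \<sigma>)" "j \<le> m"
    by (auto simp: words_def)
  then show ?case
    using Cons.IH Cons.prems ifs_map_in_K by simp
qed simp

lemma K_words: "x \<in> K \<Longrightarrow> \<exists>\<sigma>\<in>W n. x \<in> S \<sigma> ` K"
proof (induction n arbitrary: x)
  case (Suc n)
  obtain j y where y: "j \<le> m" "y \<in> K" "x = ifs_map \<rho> d j y"
    using K_eq Suc.prems by blast
  then obtain \<sigma> z where \<sigma>: "\<sigma> \<in> W n" "z \<in> K" "y = S \<sigma> z"
    using Suc.IH by blast
  then have "j # \<sigma> \<in> W (Suc n)" "x = S (j # \<sigma>) z"
    using y by (auto simp: words_def)
  with \<sigma>(2) show ?case by blast
qed simp

lemma S_bounds: "\<sigma> \<in> W n \<Longrightarrow> 0 \<le> S \<sigma> 0 \<and> S \<sigma> 0 + \<rho> ^ n \<le> 1"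
  using S_in_K[of \<sigma> n 0] S_in_K[of \<sigma> n 1] S_words[of \<sigma> n 1] zero_in_K one_in_K K_subset by auto

lemma S_image_Icc:
  assumes "\<sigma> \<in> W n"
  shows "S \<sigma> ` {0..1} = {S \<sigma> 0..S \<sigma> 0 + \<rho> ^ n}"
proof -
  have "S \<sigma> ` {0..1} = (\<lambda>x. \<rho> ^ n * x + S \<sigma> 0) ` {0..1}"
    by (intro image_cong refl) (subst S_words[OF assms], simp)
  also have "\<dots> = {S \<sigma> 0..\<rho> ^ n + S \<sigma> 0}"
    using \<rho>_pos by (simp add: image_affinity_atLeastAtMost)
  finally show ?thesis by (simp add: add.commute)
qed

lemma S_in_Icc: "\<sigma> \<in> W n \<Longrightarrow> z \<in> {0..1} \<Longrightarrow> S \<sigma> 0 \<le> S \<sigma> z \<and> S \<sigma> z \<le> S \<sigma> 0 + \<rho> ^ n"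
  using S_image_Icc by (metis atLeastAtMost_iff image_eqI)

lemma d_bounds: "j \<le> m \<Longrightarrow> 0 \<le> d j \<and> d j + \<rho> \<le> 1"
  using S_bounds[of "[j]" 1] by (simp add: words_def ifs_map_def)

section \<open>Endpoints of a level and the intervals between them\<close>

lemma pts_eq: "pts n = (\<lambda>\<sigma>. S \<sigma> 0) ` W n \<union> (\<lambda>\<sigma>. S \<sigma> 0 + \<rho> ^ n) ` W n"
proof -
  have "S \<sigma> 1 = S \<sigma> 0 + \<rho> ^ n" if "\<sigma> \<in> W n" for \<sigma>
    using S_words[OF that, of 1] by simp
  then show ?thesis
    unfolding net_points_def by auto
qed

lemma finite_pts: "finite (pts n)"
  unfolding pts_eq using finite_words by simp

lemma pts_cases:
  assumes "x \<in> pts n"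
  obtains \<sigma> where "\<sigma> \<in> W n" "x = S \<sigma> 0" | \<sigma> where "\<sigma> \<in> W n" "x = S \<sigma> 0 + \<rho> ^ n"
  using assms unfolding pts_eq by blast

lemma pts_left: "\<sigma> \<in> W n \<Longrightarrow> S \<sigma> 0 \<in> pts n"
  and pts_right: "\<sigma> \<in> W n \<Longrightarrow> S \<sigma> 0 + \<rho> ^ n \<in> pts n"
  unfolding pts_eq by auto

text \<open>The first map fixes 0 and the last one fixes 1, so appending the letter 0 or
  \<open>m\<close> keeps a left or a right end in place.\<close>

lemma pts_Suc: "pts n \<subseteq> pts (Suc n)"
proof
  fix x assume "x \<in> pts n"
  then show "x \<in> pts (Suc n)"
  proof (cases rule: pts_cases)
    case (1 \<sigma>)
    then show ?thesis
      using pts_left[OF words_snoc[of \<sigma> n 0]] by (simp add: S_snoc_0 d_0)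
  next
    case (2 \<sigma>)
    then show ?thesis
      using pts_right[OF words_snoc[of \<sigma> n m]] by (simp add: S_snoc_0 d_last algebra_simps)
  qed
qed

lemma pts_mono: "n \<le> k \<Longrightarrow> pts n \<subseteq> pts k"
  by (rule lift_Suc_mono_le[of pts, OF pts_Suc])

lemma pts_0: "pts 0 = {0, 1}"
  by (auto simp: net_points_def)

lemma zero_in_pts: "0 \<in> pts n" and one_in_pts: "1 \<in> pts n"
  using pts_mono[of 0 n] by (auto simp: pts_0)


text \<open>Net intervals by their endpoints, with one formula for all levels: at level 0 it yields
  just [0, 1], because \<open>\<rho>\<close> is a point of \<open>K\<close> strictly inside.\<close>

definition net :: "nat \<Rightarrow> real \<Rightarrow> real \<Rightarrow> bool" where
  "net n a b \<longleftrightarrow> a \<in> pts n \<and> b \<in> pts n \<and> a < b \<and> {a<..<b} \<inter> pts n = {} \<and> {a<..<b} \<inter> K \<noteq> {}"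

lemma net_less: "net n a b \<Longrightarrow> a < b"
  by (simp add: net_def)

lemma net_pts: "net n a b \<Longrightarrow> p \<in> pts n \<Longrightarrow> p \<le> a \<or> b \<le> p"
  unfolding net_def disjoint_iff greaterThanLessThan_iff by (meson not_le)

lemma net_0: "net 0 a b \<longleftrightarrow> a = 0 \<and> b = 1"
  using \<rho>_in_K \<rho>_pos \<rho>_less by (auto simp: net_def pts_0)

lemma net_intervals_eq: "net_intervals m \<rho> d K n = {{a..b} |a b. net n a b}"
proof (cases n)
  case 0
  then show ?thesis by (simp add: net_intervals_def net_0)
qed (auto simp: net_intervals_def net_def)

lemma net_intervalsE:
  assumes "\<Delta> \<in> net_intervals m \<rho> d K n"
  obtains a b where "\<Delta> = {a..b}" "net n a b"
  using assms by (auto simp: net_intervals_eq)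

lemma Icc_in_net_intervals: "{a..b} \<in> net_intervals m \<rho> d K n \<longleftrightarrow> net n a b"
  unfolding net_intervals_eq by (auto dest: net_less simp: Icc_eq_Icc)

lemma Inf_net: "net n a b \<Longrightarrow> Inf {a..b} = a" and Sup_net: "net n a b \<Longrightarrow> Sup {a..b} = b"
  by (auto dest: net_less)

text \<open>The points \<open>S \<tau> (\<rho> ^ j)\<close> of \<open>K\<close> approach the left
  end from the right, so the gap up to the next endpoint meets \<open>K\<close>. The right end of
  the same piece is one candidate for that endpoint.\<close>

lemma net_right:
  assumes "\<tau> \<in> W n"
  obtains h where "net n (S \<tau> 0) h" "h \<le> S \<tau> 0 + \<rho> ^ n"
proof -
  define P where "P = {p \<in> pts n. S \<tau> 0 < p}"
  define h where "h = Min P"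
  have P: "finite P" "S \<tau> 0 + \<rho> ^ n \<in> P"
    using pts_right[OF assms] \<rho>_pos finite_pts by (auto simp: P_def)
  then have h: "h \<in> P" "h \<le> S \<tau> 0 + \<rho> ^ n"
    unfolding h_def by (auto intro: Min_in)
  have "(\<lambda>j. \<rho> ^ n * \<rho> ^ j) \<longlonglongrightarrow> 0"
    using \<rho>_pos \<rho>_less by (intro tendsto_mult_right_zero LIMSEQ_power_zero) auto
  then have "\<forall>\<^sub>F j in sequentially. \<rho> ^ n * \<rho> ^ j < h - S \<tau> 0"
    using h by (elim order_tendstoD) (auto simp: P_def)
  then obtain j where "\<rho> ^ n * \<rho> ^ j < h - S \<tau> 0"
    by (auto simp: eventually_sequentially)
  moreover have "S \<tau> (\<rho> ^ j) \<in> K"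
    using S_in_K assms power_in_K by blast
  ultimately have "S \<tau> (\<rho> ^ j) \<in> {S \<tau> 0<..<h} \<inter> K"
    using S_words[OF assms, of "\<rho> ^ j"] \<rho>_pos by auto
  moreover have "{S \<tau> 0<..<h} \<inter> pts n = {}"
    using P(1) by (fastforce simp: P_def h_def not_less[symmetric] dest: Min_le)
  ultimately have "net n (S \<tau> 0) h"
    using h(1) pts_left[OF assms] by (auto simp: net_def P_def)
  with h(2) that show ?thesis by blast
qed

lemma net_left:
  assumes "\<tau> \<in> W n"
  obtains g where "net n g (S \<tau> 0 + \<rho> ^ n)" "S \<tau> 0 \<le> g"
proof -
  let ?y = "S \<tau> 0 + \<rho> ^ n"
  define P where "P = {p \<in> pts n. p < ?y}"
  define g where "g = Max P"
  have P: "finite P" "S \<tau> 0 \<in> P"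
    using pts_left[OF assms] \<rho>_pos finite_pts by (auto simp: P_def)
  then have g: "g \<in> P" "S \<tau> 0 \<le> g"
    unfolding g_def by (auto intro: Max_in)
  have "(\<lambda>j. \<rho> ^ n * \<rho> ^ j) \<longlonglongrightarrow> 0"
    using \<rho>_pos \<rho>_less by (intro tendsto_mult_right_zero LIMSEQ_power_zero) auto
  then have "\<forall>\<^sub>F j in sequentially. \<rho> ^ n * \<rho> ^ j < ?y - g"
    using g by (elim order_tendstoD) (auto simp: P_def)
  then obtain j where "\<rho> ^ n * \<rho> ^ j < ?y - g"
    by (auto simp: eventually_sequentially)
  moreover have "S \<tau> (1 - \<rho> ^ j) \<in> K"
    using S_in_K assms one_minus_power_in_K by blast
  ultimately have "S \<tau> (1 - \<rho> ^ j) \<in> {g<..<?y} \<inter> K"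
    using S_words[OF assms, of "1 - \<rho> ^ j"] \<rho>_pos by (auto simp: right_diff_distrib)
  moreover have "{g<..<?y} \<inter> pts n = {}"
    using P(1) by (auto simp: P_def g_def leD)
  ultimately have "net n g ?y"
    using g(1) pts_right[OF assms] by (auto simp: net_def P_def)
  with g(2) that show ?thesis by blast
qed

lemma net_at_point:
  assumes "x \<in> pts n"
  obtains a b where "net n a b" "x = a \<or> x = b"
  using assms
proof (cases rule: pts_cases)
  case (1 \<sigma>)
  then show ?thesis using net_right[OF 1(1)] that by metis
next
  case (2 \<sigma>)
  then show ?thesis using net_left[OF 2(1)] that by metis
qed

lemma net_containing:
  assumes "x \<in> K"
  obtains a b where "net n a b" "a \<le> x" "x \<le> b"
proof (cases "x \<in> pts n")
  case True
  then obtain a b where "net n a b" "x = a \<or> x = b"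
    by (rule net_at_point)
  with that net_less show ?thesis by fastforce
next
  case False
  define a where "a = Max {p \<in> pts n. p < x}"
  define b where "b = Min {p \<in> pts n. x < p}"
  have x: "0 < x" "x < 1"
    using False assms K_subset zero_in_pts[of n] one_in_pts[of n] by (force simp: less_le)+
  then have fin: "finite {p \<in> pts n. p < x}" "{p \<in> pts n. p < x} \<noteq> {}"
      "finite {p \<in> pts n. x < p}" "{p \<in> pts n. x < p} \<noteq> {}"
    using finite_pts zero_in_pts[of n] one_in_pts[of n] by auto
  have a: "a \<in> pts n" "a < x" and b: "b \<in> pts n" "x < b"
    using Max_in[OF fin(1,2)] Min_in[OF fin(3,4)] by (auto simp: a_def b_def)
  have "p \<le> a" if "p \<in> pts n" "p < x" for p
    using that fin(1) by (auto simp: a_def)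
  moreover have "b \<le> p" if "p \<in> pts n" "x < p" for p
    using that fin(3) by (auto simp: b_def)
  ultimately have "{a<..<b} \<inter> pts n = {}"
    using False by (smt (verit) disjoint_iff greaterThanLessThan_iff)
  then have "net n a b"
    using a b assms by (auto simp: net_def)
  with that a b show ?thesis by force
qed

text \<open>Endpoints of level \<open>n\<close> survive at level \<open>k\<close>, so the finer
  interval cannot straddle an end of the coarser one. The finer interval may have \<open>x\<close>
  as an endpoint, as happens at boundary points.\<close>

lemma net_subset:
  assumes "net n a b" "net k a' b'" "n \<le> k" "a < x" "x < b" "a' \<le> x" "x \<le> b'"
  shows "a \<le> a' \<and> b' \<le> b"
proof -
  have "a \<in> pts k" "b \<in> pts k"
    using assms(1,3) pts_mono by (auto simp: net_def)
  then have "a \<le> a' \<or> b' \<le> a" "b \<le> a' \<or> b' \<le> b"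
    using net_pts[OF assms(2)] by auto
  then show ?thesis
    using assms by auto
qed

lemma net_parent:
  assumes "net k a b" "n \<le> k"
  obtains a' b' where "net n a' b'" "a' \<le> a" "b \<le> b'"
proof -
  obtain x where x: "x \<in> K" "a < x" "x < b"
    using assms by (auto simp: net_def)
  \<comment> \<open>A point strictly inside avoids the endpoints of level \<open>k\<close>, hence
    those of level \<open>n\<close>, so it is interior to the coarser interval as well.\<close>
  then have "x \<notin> pts n"
    using net_pts[OF assms(1), of x] pts_mono[OF assms(2)] by auto
  obtain a' b' where n: "net n a' b'" "a' \<le> x" "x \<le> b'"
    using net_containing[OF x(1)] by blast
  then have "a' < x" "x < b'"
    using \<open>x \<notin> pts n\<close> by (auto simp: net_def less_le)
  then show ?thesis
    using net_subset[OF n(1) assms(1,2)] x n that by auto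
qed

section \<open>Neighbours\<close>

definition cover :: "nat \<Rightarrow> real \<Rightarrow> real \<Rightarrow> nat list set" where
  "cover n a b = {\<sigma> \<in> W n. S \<sigma> 0 \<le> a \<and> b \<le> S \<sigma> 0 + \<rho> ^ n}"

text \<open>Several words can give the same shift. The number of distinct shifts, not of words, is
  what is maximized later.\<close>

definition nbs :: "nat \<Rightarrow> real \<Rightarrow> real \<Rightarrow> real set" where
  "nbs n a b = (\<lambda>\<sigma>. (a - S \<sigma> 0) / \<rho> ^ n) ` cover n a b"

lemma finite_nbs: "finite (nbs n a b)"
  unfolding nbs_def cover_def using finite_words by simp

lemma neighbour_set_eq:
  assumes "a < b"
  shows "neighbour_set m \<rho> d n {a..b} = sorted_list_of_set (nbs n a b)"
proof -
  have "{(Inf {a..b} - S \<sigma> 0) / \<rho> ^ n |\<sigma>. \<sigma> \<in> W n \<and> {a..b} \<subseteq> S \<sigma> ` {0..1}} = nbs n a b"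
    using assms by (auto simp: nbs_def cover_def S_image_Icc)
  then show ?thesis
    by (simp add: neighbour_set_def)
qed

lemma norm_length_eq: "a < b \<Longrightarrow> norm_length \<rho> n {a..b} = (b - a) / \<rho> ^ n"
  by (simp add: norm_length_def)

text \<open>A piece of level \<open>n\<close> has no end strictly inside a net interval of that
  level, so once it meets the interior it contains the interval.\<close>

lemma coverI:
  assumes "net n a b" "\<sigma> \<in> W n" "a < x" "x < b" "S \<sigma> 0 \<le> x" "x \<le> S \<sigma> 0 + \<rho> ^ n"
  shows "\<sigma> \<in> cover n a b"
proof -
  have "S \<sigma> 0 \<le> a \<or> b \<le> S \<sigma> 0" "S \<sigma> 0 + \<rho> ^ n \<le> a \<or> b \<le> S \<sigma> 0 + \<rho> ^ n"
    using net_pts[OF assms(1)] pts_left[OF assms(2)] pts_right[OF assms(2)] by auto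
  then show ?thesis
    using assms by (auto simp: cover_def)
qed

text \<open>Inside the interval, \<open>K\<close> is the union of the copies of \<open>K\<close>
  attached to the neighbours. Thus whether a child meets \<open>K\<close> can be told from relative
  data.\<close>

lemma K_iff_nbs:
  assumes "net n a b" "a < y" "y < b"
  shows "y \<in> K \<longleftrightarrow> (\<exists>v\<in>nbs n a b. (y - a) / \<rho> ^ n + v \<in> K)"
proof
  assume "y \<in> K"
  then obtain \<sigma> z where \<sigma>: "\<sigma> \<in> W n" "z \<in> K" "y = S \<sigma> z"
    using K_words by blast
  then have y: "y = S \<sigma> 0 + \<rho> ^ n * z"
    using S_words by metis
  have "\<sigma> \<in> cover n a b"
    using assms \<sigma> K_subset S_in_Icc[OF \<sigma>(1), of z] by (intro coverI[of n a b \<sigma> y]) auto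
  moreover have "(y - a) / \<rho> ^ n + (a - S \<sigma> 0) / \<rho> ^ n = z"
    using y \<rho>_pos by (simp flip: add_divide_distrib)
  ultimately show "\<exists>v\<in>nbs n a b. (y - a) / \<rho> ^ n + v \<in> K"
    using \<sigma> by (force simp: nbs_def)
next
  assume "\<exists>v\<in>nbs n a b. (y - a) / \<rho> ^ n + v \<in> K"
  then obtain \<sigma> where \<sigma>: "\<sigma> \<in> W n" "(y - a) / \<rho> ^ n + (a - S \<sigma> 0) / \<rho> ^ n \<in> K"
    by (auto simp: nbs_def cover_def)
  have "S \<sigma> ((y - a) / \<rho> ^ n + (a - S \<sigma> 0) / \<rho> ^ n) = y"
    using \<rho>_pos by (subst S_words[OF \<sigma>(1)]) (simp flip: add_divide_distrib)
  with \<sigma> S_in_K show "y \<in> K" by metis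
qed

section \<open>Children of a net interval\<close>

lemma net_unique:
  assumes "net n a b" "net n a' b'" "a < x" "x < b" "a' < x" "x < b'"
  shows "a = a' \<and> b = b'"
  using net_subset[OF assms(1,2), of x] net_subset[OF assms(2,1), of x] assms by auto

lemma nbs_iff: "v \<in> nbs n a b \<longleftrightarrow> (\<exists>\<sigma>\<in>cover n a b. S \<sigma> 0 = a - \<rho> ^ n * v)"
  using \<rho>_pos by (auto simp: nbs_def field_simps image_iff)

text \<open>Coordinates relative to a net interval \<open>[a, b]\<close> of level \<open>n\<close>: \<open>x\<close> stands for
  \<open>a + \<rho>\<^sup>n x\<close>, so a neighbour \<open>v\<close> given by the word \<open>\<sigma>\<close> puts \<open>S\<^sub>\<sigma>(0)\<close> at \<open>-v\<close>, and
  appending the letter \<open>j\<close> gives the endpoints \<open>d\<^sub>j - v\<close> and \<open>d\<^sub>j + \<rho> - v\<close>.\<close>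

definition nrm_pts :: "real \<Rightarrow> real set \<Rightarrow> real set" where
  "nrm_pts l V = {0, l} \<union> {x. 0 < x \<and> x < l \<and> (\<exists>v\<in>V. \<exists>j\<le>m. x = d j - v \<or> x = d j + \<rho> - v)}"

definition nrm_child :: "real \<Rightarrow> real set \<Rightarrow> real \<Rightarrow> real \<Rightarrow> bool" where
  "nrm_child l V u w \<longleftrightarrow> u \<in> nrm_pts l V \<and> w \<in> nrm_pts l V \<and> u < w \<and>
     {u<..<w} \<inter> nrm_pts l V = {} \<and> (\<exists>x v. u < x \<and> x < w \<and> v \<in> V \<and> x + v \<in> K)"

definition nrm_nbs :: "real set \<Rightarrow> real \<Rightarrow> real \<Rightarrow> real set" where
  "nrm_nbs V u w = {(u + v - d j) / \<rho> |v j. v \<in> V \<and> j \<le> m \<and> d j - v \<le> u \<and> w \<le> d j + \<rho> - v}"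

text \<open>Neither the level nor the position of the parent enters: this is the form in which the
  vector of a child depends on its parent.\<close>

definition nrm_vec :: "real \<Rightarrow> real set \<Rightarrow> real \<Rightarrow> real \<Rightarrow> char_vec" where
  "nrm_vec l V u w = ((w - u) / \<rho>, sorted_list_of_set (nrm_nbs V u w),
     card {(u', w'). nrm_child l V u' w' \<and> (w' - u') / \<rho> = (w - u) / \<rho> \<and> u' \<le> u})"

text \<open>A new endpoint strictly inside comes from a word \<open>\<tau> @ [j]\<close>; the piece
  of the prefix \<open>\<tau>\<close> meets the interior and is therefore a neighbour.\<close>

lemma pts_Suc_iff:
  assumes net: "net n a b" and x: "0 \<le> x" "x \<le> (b - a) / \<rho> ^ n"
  shows "a + \<rho> ^ n * x \<in> pts (Suc n) \<longleftrightarrow> x \<in> nrm_pts ((b - a) / \<rho> ^ n) (nbs n a b)"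
proof (cases "x = 0 \<or> x = (b - a) / \<rho> ^ n")
  case True
  have "a \<in> pts (Suc n)" "b \<in> pts (Suc n)"
    using net pts_Suc by (auto simp: net_def)
  with True show ?thesis
    using \<rho>_pos by (auto simp: nrm_pts_def)
next
  case False
  with x have x: "0 < x" "x < (b - a) / \<rho> ^ n" by auto
  then have y: "a < a + \<rho> ^ n * x" "a + \<rho> ^ n * x < b"
    using \<rho>_pos by (simp_all add: field_simps)
  show ?thesis
  proof
    assume *: "a + \<rho> ^ n * x \<in> pts (Suc n)"
    \<comment> \<open>\<open>c\<close> is 0 for a left end and \<open>\<rho>\<close> for a right
      end, so that both cases run together.\<close>
    obtain \<sigma> c where \<sigma>: "\<sigma> \<in> W (Suc n)" "a + \<rho> ^ n * x = S \<sigma> 0 + \<rho> ^ n * c" "c = 0 \<or> c = \<rho>"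
      using * by (cases rule: pts_cases) force+
    obtain \<tau> j where \<tau>: "\<sigma> = \<tau> @ [j]" "\<tau> \<in> W n" "j \<le> m"
      using \<sigma>(1) by (rule words_Suc_cases)
    have eq: "a + \<rho> ^ n * x = S \<tau> 0 + \<rho> ^ n * (d j + c)"
      using \<sigma>(2) S_snoc_0[OF \<tau>(2), of j] \<tau>(1) by (simp add: algebra_simps)
    have "0 \<le> d j + c" "d j + c \<le> 1"
      using \<sigma>(3) d_bounds[OF \<tau>(3)] \<rho>_pos by auto
    then have "\<tau> \<in> cover n a b"
      using y \<rho>_pos by (intro coverI[OF net \<tau>(2), of "a + \<rho> ^ n * x"]) (auto simp: eq intro: mult_left_le)
    moreover have "S \<tau> 0 = a - \<rho> ^ n * (d j + c - x)"
      using eq by (simp add: algebra_simps)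
    ultimately have "d j + c - x \<in> nbs n a b"
      using nbs_iff by blast
    moreover have "x = d j - (d j + c - x) \<or> x = d j + \<rho> - (d j + c - x)"
      using \<sigma>(3) by auto
    ultimately show "x \<in> nrm_pts ((b - a) / \<rho> ^ n) (nbs n a b)"
      using x \<tau>(3) unfolding nrm_pts_def by blast
  next
    assume "x \<in> nrm_pts ((b - a) / \<rho> ^ n) (nbs n a b)"
    with x obtain v j where vj: "v \<in> nbs n a b" "j \<le> m" "x = d j - v \<or> x = d j + \<rho> - v"
      by (auto simp: nrm_pts_def)
    then obtain \<tau> where \<tau>: "\<tau> \<in> W n" "S \<tau> 0 = a - \<rho> ^ n * v"
      by (auto simp: nbs_iff cover_def)
    have "S (\<tau> @ [j]) 0 = a + \<rho> ^ n * (d j - v)"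
      using \<tau>(2) S_snoc_0[OF \<tau>(1), of j] by (simp add: algebra_simps)
    moreover from this have "S (\<tau> @ [j]) 0 + \<rho> ^ Suc n = a + \<rho> ^ n * (d j + \<rho> - v)"
      by (simp add: algebra_simps)
    ultimately have "a + \<rho> ^ n * x = S (\<tau> @ [j]) 0 \<or> a + \<rho> ^ n * x = S (\<tau> @ [j]) 0 + \<rho> ^ Suc n"
      using vj(3) by auto
    then show "a + \<rho> ^ n * x \<in> pts (Suc n)"
      using pts_left pts_right words_snoc[OF \<tau>(1) vj(2)] by metis
  qed
qed

lemma nrm_pts_bounds: "0 \<le> l \<Longrightarrow> x \<in> nrm_pts l V \<Longrightarrow> 0 \<le> x \<and> x \<le> l"
  by (auto simp: nrm_pts_def)

lemma net_child_iff:
  assumes net: "net n a b"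
  shows "net (Suc n) (a + \<rho> ^ n * u) (a + \<rho> ^ n * w) \<and> a \<le> a + \<rho> ^ n * u \<and> a + \<rho> ^ n * w \<le> b
    \<longleftrightarrow> nrm_child ((b - a) / \<rho> ^ n) (nbs n a b) u w" (is "?L \<longleftrightarrow> ?R")
proof -
  let ?l = "(b - a) / \<rho> ^ n" and ?V = "nbs n a b" and ?f = "\<lambda>x. a + \<rho> ^ n * x"
  have pos: "\<rho> ^ n > 0" and l: "0 \<le> ?l"
    using \<rho>_pos net_less[OF net] by auto
  have lt: "?f x < ?f y \<longleftrightarrow> x < y" for x y
    using pos by simp
  have "?L \<longleftrightarrow> 0 \<le> u \<and> w \<le> ?l \<and> net (Suc n) (?f u) (?f w)"
    using pos by (auto simp: pos_le_divide_eq mult.commute zero_le_mult_iff)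
  also have "\<dots> \<longleftrightarrow> ?R"
  proof (cases "0 \<le> u \<and> w \<le> ?l \<and> u < w")
    case True
    have pts: "?f x \<in> pts (Suc n) \<longleftrightarrow> x \<in> nrm_pts ?l ?V" if "u \<le> x" "x \<le> w" for x
      using True that by (intro pts_Suc_iff[OF net]) auto
    have inK: "?f x \<in> K \<longleftrightarrow> (\<exists>v\<in>?V. x + v \<in> K)" if "u < x" "x < w" for x
    proof -
      have "?f 0 < ?f x" "?f x < ?f ?l"
        unfolding lt using True that by auto
      then have "a < ?f x" "?f x < b"
        by simp_all
      then show ?thesis
        using K_iff_nbs[OF net, of "?f x"] pos by simp
    qed
    have surj: "\<exists>x. y = ?f x" for y
      using pos by (intro exI[of _ "(y - a) / \<rho> ^ n"]) auto
    have "y \<in> ?f ` {u<..<w}" if "?f u < y" "y < ?f w" for y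
    proof -
      obtain x where y: "y = ?f x"
        using surj by blast
      with that have "u < x" "x < w"
        by (simp_all only: lt)
      with y show ?thesis by auto
    qed
    then have "{?f u<..<?f w} = ?f ` {u<..<w}"
      using lt by auto
    then have "net (Suc n) (?f u) (?f w) \<longleftrightarrow> ?f u \<in> pts (Suc n) \<and> ?f w \<in> pts (Suc n) \<and> u < w \<and>
        (\<forall>x\<in>{u<..<w}. ?f x \<notin> pts (Suc n)) \<and> (\<exists>x\<in>{u<..<w}. ?f x \<in> K)"
      using pos by (auto simp: net_def)
    also have "\<dots> \<longleftrightarrow> ?R"
      using True pts inK by (auto simp: nrm_child_def)
    finally show ?thesis
      using True by blast
  next
    case False
    then show ?thesis
      using nrm_pts_bounds[OF l] pos by (auto simp: nrm_child_def dest!: net_less)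
  qed
  finally show ?thesis .
qed

text \<open>A piece containing the child lies in the piece of its prefix, which meets the interior
  of the parent and so contains it. Hence each neighbour of the child arises from one of the parent
  by a letter.\<close>

lemma nbs_child:
  assumes net: "net n a b" and child: "nrm_child ((b - a) / \<rho> ^ n) (nbs n a b) u w"
  shows "nbs (Suc n) (a + \<rho> ^ n * u) (a + \<rho> ^ n * w) = nrm_nbs (nbs n a b) u w"
proof -
  let ?f = "\<lambda>x. a + \<rho> ^ n * x"
  have pos: "\<rho> ^ n > 0"
    using \<rho>_pos by simp
  have f: "net (Suc n) (?f u) (?f w)" "a \<le> ?f u" "?f w \<le> b"
    using net_child_iff[OF net] child by auto
  show ?thesis
  proof (intro set_eqI iffI)
    fix z assume "z \<in> nbs (Suc n) (?f u) (?f w)"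
    then obtain \<sigma> where \<sigma>: "\<sigma> \<in> W (Suc n)" "S \<sigma> 0 \<le> ?f u" "?f w \<le> S \<sigma> 0 + \<rho> ^ Suc n"
        "S \<sigma> 0 = ?f u - \<rho> ^ Suc n * z"
      by (auto simp: nbs_iff cover_def)
    obtain \<tau> j where \<tau>: "\<sigma> = \<tau> @ [j]" "\<tau> \<in> W n" "j \<le> m"
      using \<sigma>(1) by (rule words_Suc_cases)
    have S\<sigma>: "S \<sigma> 0 = S \<tau> 0 + \<rho> ^ n * d j"
      using S_snoc_0[OF \<tau>(2)] \<tau>(1) by simp
    have "S \<tau> 0 \<le> S \<sigma> 0" "S \<sigma> 0 + \<rho> ^ Suc n \<le> S \<tau> 0 + \<rho> ^ n"
      using d_bounds[OF \<tau>(3)] mult_left_mono[of "d j + \<rho>" 1 "\<rho> ^ n"] pos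
      by (auto simp: S\<sigma> algebra_simps)
    then have "\<tau> \<in> cover n a b"
      using \<sigma> f net_less[OF f(1)] by (intro coverI[OF net \<tau>(2), of "(?f u + ?f w) / 2"]) auto
    define v where "v = (a - S \<tau> 0) / \<rho> ^ n"
    have v: "v \<in> nbs n a b"
      using \<open>\<tau> \<in> cover n a b\<close> by (auto simp: nbs_def v_def)
    have S\<tau>: "S \<tau> 0 = a - \<rho> ^ n * v"
      using pos by (simp add: v_def)
    have "\<rho> ^ n * (d j - v) \<le> \<rho> ^ n * u" "\<rho> ^ n * w \<le> \<rho> ^ n * (d j + \<rho> - v)"
        "\<rho> ^ n * (d j - v) = \<rho> ^ n * (u - \<rho> * z)"
      using \<sigma>(2-4) S\<sigma> S\<tau> by (simp_all add: algebra_simps)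
    then have "d j - v \<le> u" "w \<le> d j + \<rho> - v" "d j - v = u - \<rho> * z"
      using pos by (simp_all del: right_diff_distrib' )
    moreover from this have "z = (u + v - d j) / \<rho>"
      using \<rho>_pos by (simp add: field_simps)
    ultimately show "z \<in> nrm_nbs (nbs n a b) u w"
      using v \<tau>(3) unfolding nrm_nbs_def by blast
  next
    fix z assume "z \<in> nrm_nbs (nbs n a b) u w"
    then obtain v j where v: "v \<in> nbs n a b" "j \<le> m" "d j - v \<le> u" "w \<le> d j + \<rho> - v"
        "z = (u + v - d j) / \<rho>"
      by (auto simp: nrm_nbs_def)
    then obtain \<tau> where \<tau>: "\<tau> \<in> W n" "S \<tau> 0 = a - \<rho> ^ n * v"
      by (auto simp: nbs_iff cover_def)
    have S\<sigma>: "S (\<tau> @ [j]) 0 = ?f (d j - v)"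
      using S_snoc_0[OF \<tau>(1)] \<tau>(2) by (simp add: algebra_simps)
    moreover have "?f (d j - v) \<le> ?f u" "?f w \<le> ?f (d j + \<rho> - v)"
      using v(3,4) pos by auto
    then have "?f (d j - v) \<le> ?f u" "?f w \<le> ?f (d j - v) + \<rho> ^ Suc n"
      by (auto simp: algebra_simps)
    ultimately have "\<tau> @ [j] \<in> cover (Suc n) (?f u) (?f w)"
      using words_snoc[OF \<tau>(1) v(2)] by (simp add: cover_def)
    moreover have "S (\<tau> @ [j]) 0 = ?f u - \<rho> ^ Suc n * z"
    proof -
      have "\<rho> ^ Suc n * z = \<rho> ^ n * (u + v - d j)"
        using v(5) by simp
      then show ?thesis
        by (simp add: S\<sigma> algebra_simps)
    qed
    ultimately show "z \<in> nbs (Suc n) (?f u) (?f w)"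
      using nbs_iff by blast
  qed
qed

lemma net_child_Icc:
  "net_child m \<rho> d K n {a..b} {a'..b'} \<longleftrightarrow> net n a b \<and> net (Suc n) a' b' \<and> a \<le> a' \<and> b' \<le> b"
  by (auto simp: net_child_def Icc_in_net_intervals dest: net_less)

text \<open>Siblings correspond bijectively to relative children, so even the position, the one
  entry that looks at other intervals, is determined by length and neighbour set of the
  parent.\<close>

lemma char_vector_child:
  assumes net: "net n a b" and child: "nrm_child ((b - a) / \<rho> ^ n) (nbs n a b) u w"
  shows "char_vector m \<rho> d K (Suc n) {a + \<rho> ^ n * u..a + \<rho> ^ n * w}
    = nrm_vec ((b - a) / \<rho> ^ n) (nbs n a b) u w"
proof -
  let ?l = "(b - a) / \<rho> ^ n" and ?V = "nbs n a b" and ?f = "\<lambda>x. a + \<rho> ^ n * x"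
  let ?\<Delta> = "{?f u..?f w}"
  have pos: "\<rho> ^ n > 0"
    using \<rho>_pos by simp
  have f: "net (Suc n) (?f u) (?f w)" "a \<le> ?f u" "?f w \<le> b"
    using net_child_iff[OF net] child by auto
  have len: "norm_length \<rho> (Suc n) {?f x..?f y} = (y - x) / \<rho>" if "x < y" for x y
    using pos \<rho>_pos that by (subst norm_length_eq) (auto simp: field_simps)
  have uw: "u < w"
    using child by (simp add: nrm_child_def)
  \<comment> \<open>Uniqueness of the parent removes the quantifier over parents from
    \<open>net_position\<close>.\<close>
  have parent: "net_child m \<rho> d K n \<Delta>' ?\<Delta> \<longleftrightarrow> \<Delta>' = {a..b}" for \<Delta>'
  proof
    assume *: "net_child m \<rho> d K n \<Delta>' ?\<Delta>"
    then obtain a' b' where \<Delta>': "\<Delta>' = {a'..b'}" "net n a' b'"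
      unfolding net_child_def by (blast elim: net_intervalsE)
    then have "a' \<le> ?f u" "?f w \<le> b'"
      using * by (auto simp: net_child_Icc)
    then have "a = a' \<and> b = b'"
      using f net_less[OF f(1)]
      by (intro net_unique[OF net \<Delta>'(2), of "(?f u + ?f w) / 2"]) auto
    with \<Delta>' show "\<Delta>' = {a..b}" by simp
  qed (use net f in \<open>simp add: net_child_Icc\<close>)
  let ?P = "{(u', w'). nrm_child ?l ?V u' w' \<and> (w' - u') / \<rho> = (w - u) / \<rho> \<and> u' \<le> u}"
  have "{\<Gamma>. (\<exists>\<Delta>'. net_child m \<rho> d K n \<Delta>' ?\<Delta> \<and> net_child m \<rho> d K n \<Delta>' \<Gamma>) \<and>
          norm_length \<rho> (Suc n) \<Gamma> = norm_length \<rho> (Suc n) ?\<Delta> \<and> Inf \<Gamma> \<le> Inf ?\<Delta>}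
      = (\<lambda>(u, w). {?f u..?f w}) ` ?P" (is "?A = ?g ` ?P")
  proof (intro set_eqI iffI)
    fix \<Gamma> assume \<Gamma>: "\<Gamma> \<in> ?A"
    then have c: "net_child m \<rho> d K n {a..b} \<Gamma>"
      by (simp add: parent)
    then obtain g h where gh: "\<Gamma> = {g..h}" "net (Suc n) g h"
      unfolding net_child_def by (blast elim: net_intervalsE)
    define u' where "u' = (g - a) / \<rho> ^ n"
    define w' where "w' = (h - a) / \<rho> ^ n"
    have g: "g = ?f u'" "h = ?f w'"
      using pos by (auto simp: u'_def w'_def)
    have ch: "nrm_child ?l ?V u' w'"
      using c gh(2) unfolding net_child_iff[OF net, symmetric] g gh(1) net_child_Icc by blast
    then have "u' < w'"
      by (simp add: nrm_child_def)
    then have "(w' - u') / \<rho> = (w - u) / \<rho>" "?f u' \<le> ?f u"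
      using \<Gamma> len uw f(1) gh(2) unfolding gh(1) g by (auto simp: Inf_net)
    then show "\<Gamma> \<in> ?g ` ?P"
      using ch pos unfolding gh(1) g by (intro image_eqI[of _ _ "(u', w')"]) auto
  next
    fix \<Gamma> assume "\<Gamma> \<in> ?g ` ?P"
    then obtain u' w' where *: "\<Gamma> = {?f u'..?f w'}" "nrm_child ?l ?V u' w'"
        "(w' - u') / \<rho> = (w - u) / \<rho>" "u' \<le> u"
      by auto
    have f': "net (Suc n) (?f u') (?f w')" "a \<le> ?f u'" "?f w' \<le> b"
      using net_child_iff[OF net] *(2) by auto
    have "u' < w'"
      using *(2) by (simp add: nrm_child_def)
    have "net_child m \<rho> d K n {a..b} \<Gamma>"
      using net f' by (simp add: *(1) net_child_Icc)
    moreover have "norm_length \<rho> (Suc n) \<Gamma> = norm_length \<rho> (Suc n) ?\<Delta>"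
      using len \<open>u' < w'\<close> uw *(3) by (simp add: *(1))
    moreover have "Inf \<Gamma> \<le> Inf ?\<Delta>"
      using Inf_net[OF f'(1)] Inf_net[OF f(1)] *(4) pos by (simp add: *(1))
    ultimately show "\<Gamma> \<in> ?A"
      by (simp add: parent)
  qed
  moreover have "inj_on ?g ?P"
  proof (rule inj_onI, clarify)
    fix u1 w1 u2 w2
    assume "nrm_child ?l ?V u1 w1" "nrm_child ?l ?V u2 w2" "{?f u1..?f w1} = {?f u2..?f w2}"
    then have "?f u1 = ?f u2" "?f w1 = ?f w2"
      using pos by (auto simp: Icc_eq_Icc nrm_child_def)
    then show "u1 = u2 \<and> w1 = w2"
      by simp
  qed
  ultimately have "net_position m \<rho> d K (Suc n) ?\<Delta> = card ?P"
    by (simp add: net_position_def card_image)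
  then show ?thesis
    unfolding char_vector_def nrm_vec_def
    using uw len neighbour_set_eq[OF net_less[OF f(1)]] nbs_child[OF assms] by simp
qed

section \<open>Essential points\<close>

lemma essential_intervalE:
  assumes "essential_interval m \<rho> d K n {a..b}"
  shows "net n a b"
  using assms by (simp add: essential_interval_def Icc_in_net_intervals)

lemma essential_interval_child:
  assumes "essential_interval m \<rho> d K n \<Delta>" "net_child m \<rho> d K n \<Delta> \<Gamma>"
  shows "essential_interval m \<rho> d K (Suc n) \<Gamma>"
proof -
  obtain E where E: "essential_class m \<rho> d K E" "char_vector m \<rho> d K n \<Delta> \<in> E"
    using assms(1) by (auto simp: essential_interval_def)
  moreover have "char_child m \<rho> d K (char_vector m \<rho> d K n \<Delta>) (char_vector m \<rho> d K (Suc n) \<Gamma>)"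
    using assms(2) unfolding char_child_def by blast
  ultimately have "char_vector m \<rho> d K (Suc n) \<Gamma> \<in> E"
    unfolding essential_class_def by blast
  then show ?thesis
    using E assms(2) by (auto simp: essential_interval_def net_child_def)
qed

lemma essential_interval_descendant:
  assumes "essential_interval m \<rho> d K n {a..b}" "n \<le> k" "net k a' b'" "a \<le> a'" "b' \<le> b"
  shows "essential_interval m \<rho> d K k {a'..b'}"
  using assms(2-)
proof (induction k arbitrary: a' b' rule: dec_induct)
  case base
  have "a' = a \<and> b' = b"
    using net_unique[OF base(1) essential_intervalE[OF assms(1)], of "(a' + b') / 2"]
      base net_less[OF base(1)] by auto
  with assms(1) show ?case by simp
next
  case (step k)
  obtain g h where gh: "net k g h" "g \<le> a'" "b' \<le> h"
    using net_parent[OF step.prems(1), of k] by auto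
  have "a \<le> g \<and> h \<le> b"
    using gh step net_less[OF step.prems(1)]
    by (intro net_subset[OF essential_intervalE[OF assms(1)] gh(1), of "(a' + b') / 2"]) auto
  then have "essential_interval m \<rho> d K k {g..h}"
    using step.IH gh(1) by blast
  moreover have "net_child m \<rho> d K k {g..h} {a'..b'}"
    using gh step.prems by (simp add: net_child_Icc)
  ultimately show ?case
    by (rule essential_interval_child)
qed

text \<open>If \<open>x\<close> is never an endpoint, it is interior essential by definition.
  Otherwise, at a fine enough level, all net intervals that touch \<open>x\<close> lie in
  \<open>[a, b]\<close> and inherit essentiality.\<close>

lemma truly_essential_interior:
  assumes ess: "essential_interval m \<rho> d K n {a..b}" and x: "x \<in> K" "a < x" "x < b"
  shows "truly_essential m \<rho> d K x"
proof (cases "boundary_point m \<rho> d K x")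
  case False
  then show ?thesis
    using assms unfolding truly_essential_def interior_essential_def
    by (auto intro!: exI[of _ n] exI[of _ "{a..b}"])
next
  case True
  then obtain k g h where gh: "net k g h" "x = g \<or> x = h"
    unfolding boundary_point_def by (metis net_intervalsE Inf_net Sup_net)
  \<comment> \<open>At this level \<open>x\<close> is still an endpoint, and the level is no coarser
    than that of \<open>[a, b]\<close>.\<close>
  define j where "j = max n k"
  have "x \<in> pts k"
    using gh by (auto simp: net_def)
  then have "x \<in> pts j"
    using pts_mono[of k j] by (auto simp: j_def)
  then obtain a' b' where ab': "net j a' b'" "x = a' \<or> x = b'"
    by (rule net_at_point)
  have sub: "essential_interval m \<rho> d K j {g..h}" if "net j g h" "g \<le> x" "x \<le> h" for g h
    using net_subset[OF essential_intervalE[OF ess] that(1), of x] that x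
    by (intro essential_interval_descendant[OF ess]) (auto simp: j_def)
  have "boundary_essential m \<rho> d K x"
    unfolding boundary_essential_def
  proof (intro conjI exI allI impI)
    show "x \<in> K" by fact
    show "essential_interval m \<rho> d K j {a'..b'}"
      using ab' net_less[OF ab'(1)] by (intro sub) auto
    show "x = Inf {a'..b'} \<or> x = Sup {a'..b'}"
      using ab' Inf_net Sup_net by metis
    fix \<Delta>' assume "other_net_interval m \<rho> d K j x {a'..b'} \<Delta>'"
    then have *: "\<Delta>' \<in> net_intervals m \<rho> d K j" "x = Inf \<Delta>' \<or> x = Sup \<Delta>'"
      by (auto simp: other_net_interval_def)
    obtain g h where gh: "\<Delta>' = {g..h}" "net j g h"
      using *(1) by (rule net_intervalsE)
    then have "x = g \<or> x = h"
      using *(2) Inf_net Sup_net by metis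
    then show "essential_interval m \<rho> d K j \<Delta>'"
      using gh net_less[OF gh(2)] by (auto intro: sub)
  qed
  then show ?thesis
    by (simp add: truly_essential_def)
qed

section \<open>Persistent net intervals\<close>

lemma char_vector_eqD:
  assumes "net n a b" "net k a' b'" "char_vector m \<rho> d K n {a..b} = char_vector m \<rho> d K k {a'..b'}"
  shows "(b - a) / \<rho> ^ n = (b' - a') / \<rho> ^ k" "nbs n a b = nbs k a' b'"
  using assms(3) net_less[OF assms(1)] net_less[OF assms(2)]
  by (auto simp: char_vector_def norm_length_eq neighbour_set_eq
      sorted_list_of_set_inject finite_nbs)

lemma cover_nonempty: "net n a b \<Longrightarrow> cover n a b \<noteq> {}"
proof -
  assume net: "net n a b"
  then obtain x where x: "x \<in> K" "a < x" "x < b"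
    by (auto simp: net_def)
  then obtain \<sigma> z where \<sigma>: "\<sigma> \<in> W n" "z \<in> K" "x = S \<sigma> z"
    using K_words by blast
  then have "\<sigma> \<in> cover n a b"
    using x K_subset S_in_Icc[OF \<sigma>(1), of z] by (intro coverI[OF net \<sigma>(1), of x]) auto
  then show ?thesis by blast
qed

lemma net_child_cases:
  assumes "net_child m \<rho> d K n {a..b} \<Gamma>"
  obtains u w where "\<Gamma> = {a + \<rho> ^ n * u..a + \<rho> ^ n * w}"
    "nrm_child ((b - a) / \<rho> ^ n) (nbs n a b) u w" "net n a b"
proof -
  obtain g h where gh: "\<Gamma> = {g..h}" "net (Suc n) g h"
    using assms unfolding net_child_def by (blast elim: net_intervalsE)
  define u where "u = (g - a) / \<rho> ^ n"
  define w where "w = (h - a) / \<rho> ^ n"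
  have g: "g = a + \<rho> ^ n * u" "h = a + \<rho> ^ n * w"
    by (auto simp: u_def w_def)
  have c: "net n a b" "net (Suc n) g h" "a \<le> g" "h \<le> b"
    using assms by (auto simp: gh(1) net_child_Icc)
  then have "nrm_child ((b - a) / \<rho> ^ n) (nbs n a b) u w"
    using net_child_iff[OF c(1), of u w] c(2-) unfolding g[symmetric] by blast
  then show ?thesis
    using gh(1) g c(1) by (intro that[of u w]) simp_all
qed

lemma net_has_child:
  assumes "net n a b"
  obtains a' b' where "net (Suc n) a' b'" "a \<le> a'" "b' \<le> b"
proof -
  obtain x where x: "x \<in> K" "a < x" "x < b"
    using assms by (auto simp: net_def)
  obtain a' b' where "net (Suc n) a' b'" "a' \<le> x" "x \<le> b'"
    using net_containing[OF x(1)] by blast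
  with net_subset[OF assms this(1), of x] x that show ?thesis by auto
qed

lemma finite_nrm_pts:
  assumes "finite V"
  shows "finite (nrm_pts l V)"
proof (rule finite_subset)
  show "nrm_pts l V \<subseteq> {0, l} \<union> (\<lambda>(v, j). d j - v) ` (V \<times> {..m}) \<union> (\<lambda>(v, j). d j + \<rho> - v) ` (V \<times> {..m})"
    by (force simp: nrm_pts_def)
qed (use assms in simp)

text \<open>The position is left out, because maximality says nothing about the siblings of a
  copy.\<close>

definition persistent :: "nat \<Rightarrow> real \<Rightarrow> real \<Rightarrow> bool" where
  "persistent n a b \<longleftrightarrow> net n a b \<and>
     (\<forall>k. \<forall>\<omega>\<in>W k. net (k + n) (S \<omega> a) (S \<omega> b) \<and> nbs (k + n) (S \<omega> a) (S \<omega> b) = nbs n a b)"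

text \<open>In relative coordinates the interval and its copies have the same children. The second
  claim covers the full vector, since the siblings of a child depend on the parent only.\<close>

lemma persistent_child:
  assumes per: "persistent n a b" and child: "nrm_child ((b - a) / \<rho> ^ n) (nbs n a b) u w"
  defines "a' \<equiv> a + \<rho> ^ n * u" and "b' \<equiv> a + \<rho> ^ n * w"
  shows "persistent (Suc n) a' b'"
    and "\<omega> \<in> W k \<Longrightarrow>
      char_vector m \<rho> d K (k + Suc n) {S \<omega> a'..S \<omega> b'} = char_vector m \<rho> d K (Suc n) {a'..b'}"
proof -
  have net: "net n a b"
    using per by (simp add: persistent_def)
  have *: "net (k + Suc n) (S \<omega> a') (S \<omega> b') \<and> nbs (k + Suc n) (S \<omega> a') (S \<omega> b') = nbs (Suc n) a' b' \<and>
      char_vector m \<rho> d K (k + Suc n) {S \<omega> a'..S \<omega> b'} = char_vector m \<rho> d K (Suc n) {a'..b'}"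
    if \<omega>: "\<omega> \<in> W k" for \<omega> k
  proof -
    have S: "S \<omega> (a + \<rho> ^ n * x) = S \<omega> a + \<rho> ^ (k + n) * x" for x
      unfolding S_words[OF \<omega>, of "a + \<rho> ^ n * x"] S_words[OF \<omega>, of a]
      by (simp add: algebra_simps power_add)
    have n: "net (k + n) (S \<omega> a) (S \<omega> b)" and V: "nbs (k + n) (S \<omega> a) (S \<omega> b) = nbs n a b"
      using per \<omega> by (auto simp: persistent_def)
    have "S \<omega> b - S \<omega> a = \<rho> ^ k * (b - a)"
      unfolding S_words[OF \<omega>, of b] S_words[OF \<omega>, of a] by (simp add: algebra_simps)
    then have l: "(S \<omega> b - S \<omega> a) / \<rho> ^ (k + n) = (b - a) / \<rho> ^ n"
      by (simp add: power_add)
    have c: "nrm_child ((S \<omega> b - S \<omega> a) / \<rho> ^ (k + n)) (nbs (k + n) (S \<omega> a) (S \<omega> b)) u w"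
      using child by (simp only: l V)
    have "net (Suc (k + n)) (S \<omega> a') (S \<omega> b')"
      using net_child_iff[OF n] c unfolding a'_def b'_def S by blast
    moreover have "nbs (Suc (k + n)) (S \<omega> a') (S \<omega> b') = nbs (Suc n) a' b'"
      using nbs_child[OF n c] nbs_child[OF net child] V unfolding a'_def b'_def S by simp
    moreover have "char_vector m \<rho> d K (Suc (k + n)) {S \<omega> a'..S \<omega> b'} = char_vector m \<rho> d K (Suc n) {a'..b'}"
      using char_vector_child[OF n c] char_vector_child[OF net child] V l unfolding a'_def b'_def S by simp
    ultimately show ?thesis by simp
  qed
  have "net (Suc n) a' b'"
    using net_child_iff[OF net] child by (auto simp: a'_def b'_def)
  with * show "persistent (Suc n) a' b'"
    by (simp add: persistent_def)
  show "char_vector m \<rho> d K (k + Suc n) {S \<omega> a'..S \<omega> b'} = char_vector m \<rho> d K (Suc n) {a'..b'}"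
    if "\<omega> \<in> W k"
    using *[OF that] by blast
qed

text \<open>An edge between vectors may be witnessed below an unrelated interval. Equal vectors have
  equal length and neighbour set, so the witnessed child can be placed below the persistent interval
  at the same relative coordinates.\<close>

lemma persistent_reachable:
  assumes "(char_child m \<rho> d K)\<^sup>*\<^sup>* \<alpha> \<beta>" "persistent n a b" "\<alpha> = char_vector m \<rho> d K n {a..b}"
  shows "\<exists>n' a' b'. persistent n' a' b' \<and> \<beta> = char_vector m \<rho> d K n' {a'..b'}"
  using assms
proof (induction arbitrary: rule: rtranclp_induct)
  case (step \<beta> \<gamma>)
  then obtain n a b where ab: "persistent n a b" "\<beta> = char_vector m \<rho> d K n {a..b}"
    by blast
  then have net: "net n a b"
    by (simp add: persistent_def)
  obtain k \<Delta>' \<Delta> where *: "net_child m \<rho> d K k \<Delta>' \<Delta>" "\<beta> = char_vector m \<rho> d K k \<Delta>'"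
      "\<gamma> = char_vector m \<rho> d K (Suc k) \<Delta>"
    using step.hyps(2) by (auto simp: char_child_def)
  obtain g h where gh: "\<Delta>' = {g..h}" "net k g h"
    using *(1) unfolding net_child_def by (blast elim: net_intervalsE)
  obtain u w where uw: "\<Delta> = {g + \<rho> ^ k * u..g + \<rho> ^ k * w}" "nrm_child ((h - g) / \<rho> ^ k) (nbs k g h) u w"
    using net_child_cases[OF *(1)[unfolded gh(1)]] by blast
  have eq: "(b - a) / \<rho> ^ n = (h - g) / \<rho> ^ k" "nbs n a b = nbs k g h"
    using char_vector_eqD[OF net gh(2)] ab(2) *(2) gh(1) by simp_all
  have c: "nrm_child ((b - a) / \<rho> ^ n) (nbs n a b) u w"
    using uw(2) by (simp only: eq)
  have "\<gamma> = char_vector m \<rho> d K (Suc n) {a + \<rho> ^ n * u..a + \<rho> ^ n * w}"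
    unfolding *(3) uw(1) char_vector_child[OF gh(2) uw(2)] char_vector_child[OF net c] eq ..
  with persistent_child(1)[OF ab(1) c] show ?case by blast
qed blast

end

section \<open>Finite type\<close>

locale finite_type_ifs = ifs +
  assumes finite_type: "finite_type m \<rho> d"
begin

lemma finite_differences:
  obtains F where "finite F" "\<And>n \<sigma> \<tau>. \<sigma> \<in> W n \<Longrightarrow> \<tau> \<in> W n \<Longrightarrow> \<bar>S \<sigma> 0 - S \<tau> 0\<bar> \<le> \<rho> ^ n \<Longrightarrow>
    (S \<sigma> 0 - S \<tau> 0) / \<rho> ^ n \<in> F"
proof -
  obtain F where F: "finite F" "\<forall>n\<ge>1. \<forall>\<sigma>\<in>W n. \<forall>\<tau>\<in>W n.
      \<bar>S \<sigma> 0 - S \<tau> 0\<bar> / \<rho> ^ n > 1 \<or> (S \<sigma> 0 - S \<tau> 0) / \<rho> ^ n \<in> F"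
    using finite_type by (auto simp: finite_type_def)
  show ?thesis
  \<comment> \<open>Finite type speaks of levels from 1 on; at level 0 there is only the empty word,
    with difference 0.\<close>
  proof (rule that[of "insert 0 F"])
    show "(S \<sigma> 0 - S \<tau> 0) / \<rho> ^ n \<in> insert 0 F"
      if "\<sigma> \<in> W n" "\<tau> \<in> W n" "\<bar>S \<sigma> 0 - S \<tau> 0\<bar> \<le> \<rho> ^ n" for n \<sigma> \<tau>
    proof (cases "n = 0")
      case False
      have "\<not> \<bar>S \<sigma> 0 - S \<tau> 0\<bar> / \<rho> ^ n > 1"
        using that(3) \<rho>_pos by (simp add: field_simps)
      then show ?thesis
        using F(2) that False by (metis One_nat_def Suc_leI insertCI neq0_conv)
    qed (use that in auto)
  qed (use F in simp)
qed

text \<open>Seen from a piece containing it, an end of a net interval sits at a difference of two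
  left ends, or at such a difference plus 1 if it is a right end. Lengths are differences of two
  such numbers.\<close>

lemma finite_shapes:
  obtains F where "finite F" "\<And>n a b. net n a b \<Longrightarrow> (b - a) / \<rho> ^ n \<in> F \<and> nbs n a b \<subseteq> F"
proof -
  obtain F where F: "finite F" "\<And>n \<sigma> \<tau>. \<sigma> \<in> W n \<Longrightarrow> \<tau> \<in> W n \<Longrightarrow> \<bar>S \<sigma> 0 - S \<tau> 0\<bar> \<le> \<rho> ^ n \<Longrightarrow>
    (S \<sigma> 0 - S \<tau> 0) / \<rho> ^ n \<in> F"
    using finite_differences by blast
  define G where "G = F \<union> (\<lambda>x. x + 1) ` F"
  have G: "(p - S \<sigma> 0) / \<rho> ^ n \<in> G" if "\<sigma> \<in> W n" "p \<in> pts n" "S \<sigma> 0 \<le> p" "p \<le> S \<sigma> 0 + \<rho> ^ n" for p n \<sigma>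
    using that(2)
  proof (cases rule: pts_cases)
    case (1 \<tau>)
    then show ?thesis
      using F(2)[OF 1(1) that(1)] that by (auto simp: G_def)
  next
    case (2 \<tau>)
    have "(p - S \<sigma> 0) / \<rho> ^ n = (S \<tau> 0 - S \<sigma> 0) / \<rho> ^ n + 1"
      by (simp add: 2(2) field_simps)
    then show ?thesis
      using F(2)[OF 2(1) that(1)] that 2(2) by (auto simp: G_def)
  qed
  show ?thesis
  proof (rule that[of "G \<union> (\<lambda>(x, y). x - y) ` (G \<times> G)"])
    show "finite (G \<union> (\<lambda>(x, y). x - y) ` (G \<times> G))"
      using F(1) by (simp add: G_def)
    fix n a b assume net: "net n a b"
    have ends: "(a - S \<sigma> 0) / \<rho> ^ n \<in> G" "(b - S \<sigma> 0) / \<rho> ^ n \<in> G" if "\<sigma> \<in> cover n a b" for \<sigma>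
      using net that by (auto intro!: G simp: net_def cover_def)
    obtain \<sigma> where \<sigma>: "\<sigma> \<in> cover n a b"
      using cover_nonempty[OF net] by blast
    have "(b - a) / \<rho> ^ n = (b - S \<sigma> 0) / \<rho> ^ n - (a - S \<sigma> 0) / \<rho> ^ n"
      by (simp flip: diff_divide_distrib)
    then have "(b - a) / \<rho> ^ n \<in> (\<lambda>(x, y). x - y) ` (G \<times> G)"
      using ends[OF \<sigma>] by (intro image_eqI[of _ _ "((b - S \<sigma> 0) / \<rho> ^ n, (a - S \<sigma> 0) / \<rho> ^ n)"]) auto
    moreover have "nbs n a b \<subseteq> G"
      using ends by (auto simp: nbs_def)
    ultimately show "(b - a) / \<rho> ^ n \<in> G \<union> (\<lambda>(x, y). x - y) ` (G \<times> G) \<and>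
        nbs n a b \<subseteq> G \<union> (\<lambda>(x, y). x - y) ` (G \<times> G)"
      by blast
  qed
qed

text \<open>The position is controlled through the parent: every vector above level 0 is
  \<open>nrm_vec\<close> of a parent shape, and each of the finitely many shapes has finitely many
  children.\<close>

lemma finite_char_vectors: "finite (char_vectors m \<rho> d K)"
proof -
  obtain F where F: "finite F" "\<And>n a b. net n a b \<Longrightarrow> (b - a) / \<rho> ^ n \<in> F \<and> nbs n a b \<subseteq> F"
    using finite_shapes by blast
  let ?C = "\<lambda>(l, V). (\<lambda>(u, w). nrm_vec l V u w) ` {(u, w). nrm_child l V u w}"
  show ?thesis
  proof (rule finite_subset)
    show "char_vectors m \<rho> d K \<subseteq> insert (char_vector m \<rho> d K 0 {0..1}) (\<Union>p\<in>F \<times> Pow F. ?C p)"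
    proof
      fix \<alpha> assume "\<alpha> \<in> char_vectors m \<rho> d K"
      then obtain n a b where \<alpha>: "net n a b" "\<alpha> = char_vector m \<rho> d K n {a..b}"
        unfolding char_vectors_def by (blast elim: net_intervalsE)
      show "\<alpha> \<in> insert (char_vector m \<rho> d K 0 {0..1}) (\<Union>p\<in>F \<times> Pow F. ?C p)"
      proof (cases n)
        case 0
        then show ?thesis
          using \<alpha> by (simp add: net_0)
      next
        case (Suc k)
        obtain g h where gh: "net k g h" "g \<le> a" "b \<le> h"
          using net_parent[OF \<alpha>(1), of k] Suc by auto
        then have "net_child m \<rho> d K k {g..h} {a..b}"
          using \<alpha>(1) Suc by (simp add: net_child_Icc)
        then obtain u w where uw: "{a..b} = {g + \<rho> ^ k * u..g + \<rho> ^ k * w}"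
            "nrm_child ((h - g) / \<rho> ^ k) (nbs k g h) u w"
          by (rule net_child_cases)
        have "\<alpha> = nrm_vec ((h - g) / \<rho> ^ k) (nbs k g h) u w"
          unfolding \<alpha>(2) Suc uw(1) by (rule char_vector_child[OF gh(1) uw(2)])
        then have "\<alpha> \<in> ?C ((h - g) / \<rho> ^ k, nbs k g h)"
          using uw(2) by auto
        then show ?thesis
          using F(2)[OF gh(1)] by blast
      qed
    qed
    have "finite (?C (l, V))" if "V \<subseteq> F" for l V
    proof -
      have "{(u, w). nrm_child l V u w} \<subseteq> nrm_pts l V \<times> nrm_pts l V"
        by (auto simp: nrm_child_def)
      moreover have "finite (nrm_pts l V)"
        using that F(1) by (intro finite_nrm_pts finite_subset[of V F])
      ultimately show ?thesis
        by (auto intro!: finite_imageI intro: finite_subset)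
    qed
    then show "finite (insert (char_vector m \<rho> d K 0 {0..1}) (\<Union>p\<in>F \<times> Pow F. ?C p))"
      using F(1) by auto
  qed
qed

text \<open>A net interval inside a copy keeps all neighbours of the original, shifted by its offset
  from the left end of the copy. A piece with an end strictly inside the copy cannot be one of them,
  so a net interval next to that end and inside the piece would exceed the maximum.\<close>

lemma ex_persistent: "\<exists>n a b. persistent n a b"
proof -
  obtain F where F: "finite F" "\<And>n a b. net n a b \<Longrightarrow> (b - a) / \<rho> ^ n \<in> F \<and> nbs n a b \<subseteq> F"
    using finite_shapes by blast
  define P where "P c \<longleftrightarrow> (\<exists>n a b. net n a b \<and> c = card (nbs n a b))" for c
  have le: "c \<le> card F" if "P c" for c
    using that F by (auto simp: P_def intro!: card_mono)
  have "P (card (nbs 0 0 1))"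
    unfolding P_def using net_0 by blast
  then have P: "P (Greatest P)" "\<And>c. P c \<Longrightarrow> c \<le> Greatest P"
    using GreatestI_nat[of P] Greatest_le_nat[of P] le by blast+
  obtain n a b where net: "net n a b" and max: "\<And>k g h. net k g h \<Longrightarrow> card (nbs k g h) \<le> card (nbs n a b)"
    using P unfolding P_def by metis
  have "net (k + n) (S \<omega> a) (S \<omega> b) \<and> nbs (k + n) (S \<omega> a) (S \<omega> b) = nbs n a b"
    if \<omega>: "\<omega> \<in> W k" for k \<omega>
  proof -
    have S: "S \<omega> x = S \<omega> 0 + \<rho> ^ k * x" for x
      by (rule S_words[OF \<omega>])
    have pos: "\<rho> ^ k > 0"
      using \<rho>_pos by simp
    have mono: "S \<omega> x \<le> S \<omega> y \<longleftrightarrow> x \<le> y" for x y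
      using pos unfolding S[of x] S[of y] by simp
    have cover: "\<omega> @ \<sigma> \<in> W (k + n)" "S (\<omega> @ \<sigma>) 0 \<le> S \<omega> a" "S \<omega> b \<le> S (\<omega> @ \<sigma>) 0 + \<rho> ^ (k + n)"
      if "\<sigma> \<in> cover n a b" for \<sigma>
    proof -
      have \<sigma>: "\<sigma> \<in> W n" "S \<sigma> 0 \<le> a" "b \<le> S \<sigma> 0 + \<rho> ^ n"
        using that by (auto simp: cover_def)
      show "\<omega> @ \<sigma> \<in> W (k + n)"
        using words_append \<omega> \<sigma>(1) by blast
      show "S (\<omega> @ \<sigma>) 0 \<le> S \<omega> a"
        using \<sigma>(2) by (simp add: S_append mono)
      have "S \<omega> b \<le> S \<omega> (S \<sigma> 0 + \<rho> ^ n)"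
        using \<sigma>(3) mono by blast
      also have "\<dots> = S (\<omega> @ \<sigma>) 0 + \<rho> ^ (k + n)"
        unfolding S_append S[of "S \<sigma> 0 + \<rho> ^ n"] S[of "S \<sigma> 0"] by (simp add: algebra_simps power_add)
      finally show "S \<omega> b \<le> S (\<omega> @ \<sigma>) 0 + \<rho> ^ (k + n)" .
    qed
    have old: "(\<lambda>v. v + (g - S \<omega> a) / \<rho> ^ (k + n)) ` nbs n a b \<subseteq> nbs (k + n) g h"
      if gh: "S \<omega> a \<le> g" "h \<le> S \<omega> b" for g h
    proof
      fix z assume "z \<in> (\<lambda>v. v + (g - S \<omega> a) / \<rho> ^ (k + n)) ` nbs n a b"
      then obtain \<sigma> where \<sigma>: "\<sigma> \<in> cover n a b" "z = (a - S \<sigma> 0) / \<rho> ^ n + (g - S \<omega> a) / \<rho> ^ (k + n)"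
        by (auto simp: nbs_def)
      have "(a - S \<sigma> 0) / \<rho> ^ n = (S \<omega> a - S (\<omega> @ \<sigma>) 0) / \<rho> ^ (k + n)"
        unfolding S_append S[of a] S[of "S \<sigma> 0"] by (simp add: power_add flip: right_diff_distrib)
      then have "z = (g - S (\<omega> @ \<sigma>) 0) / \<rho> ^ (k + n)"
        by (simp add: \<sigma>(2) flip: add_divide_distrib)
      moreover have "\<omega> @ \<sigma> \<in> cover (k + n) g h"
        using cover[OF \<sigma>(1)] gh by (auto simp: cover_def)
      ultimately show "z \<in> nbs (k + n) g h"
        by (auto simp: nbs_def)
    qed
    have card_shift: "card ((\<lambda>v. v + c) ` nbs n a b) = card (nbs n a b)" for c :: real
      by (intro card_image) (auto simp: inj_on_def)
    \<comment> \<open>\<open>inside\<close> says that the piece of \<open>\<tau>\<close> does not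
      contain the copy, whereas all pieces of words \<open>\<omega> @ \<sigma>\<close> do; equal
      shifts would force equal left ends.\<close>
    have new: False
      if \<tau>: "\<tau> \<in> W (k + n)" "S \<tau> 0 \<le> g" "h \<le> S \<tau> 0 + \<rho> ^ (k + n)"
        and gh: "net (k + n) g h" "S \<omega> a \<le> g" "h \<le> S \<omega> b"
        and inside: "S \<omega> a < S \<tau> 0 \<or> S \<tau> 0 + \<rho> ^ (k + n) < S \<omega> b" for \<tau> g h
    proof -
      let ?V = "(\<lambda>v. v + (g - S \<omega> a) / \<rho> ^ (k + n)) ` nbs n a b"
      let ?v = "(g - S \<tau> 0) / \<rho> ^ (k + n)"
      have "?v \<notin> ?V"
      proof
        assume "?v \<in> ?V"
        then obtain \<sigma> where \<sigma>: "\<sigma> \<in> cover n a b"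
            "(g - S \<tau> 0) / \<rho> ^ (k + n) = (a - S \<sigma> 0) / \<rho> ^ n + (g - S \<omega> a) / \<rho> ^ (k + n)"
          by (auto simp: nbs_def)
        have "(a - S \<sigma> 0) / \<rho> ^ n = (S \<omega> a - S (\<omega> @ \<sigma>) 0) / \<rho> ^ (k + n)"
          unfolding S_append S[of a] S[of "S \<sigma> 0"] by (simp add: power_add flip: right_diff_distrib)
        then have "(g - S \<tau> 0) / \<rho> ^ (k + n) = (g - S (\<omega> @ \<sigma>) 0) / \<rho> ^ (k + n)"
          using \<sigma>(2) by (simp flip: add_divide_distrib)
        then have "S \<tau> 0 = S (\<omega> @ \<sigma>) 0"
          by simp
        then show False
          using inside cover[OF \<sigma>(1)] by auto
      qed
      moreover have "?v \<in> nbs (k + n) g h"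
        using \<tau> by (auto simp: nbs_def cover_def)
      ultimately have "card (insert ?v ?V) \<le> card (nbs (k + n) g h)"
        using old[OF gh(2,3)] by (intro card_mono finite_nbs) auto
      then have "Suc (card (nbs n a b)) \<le> card (nbs (k + n) g h)"
        using \<open>?v \<notin> ?V\<close> finite_nbs[of n a b] card_shift by simp
      then show False
        using max[OF gh(1)] by simp
    qed
    have lift: "S \<omega> p \<in> pts (k + n)" if p: "p \<in> pts n" for p
      using p
    proof (cases rule: pts_cases)
      case (1 \<sigma>)
      then show ?thesis
        using pts_left[OF words_append[OF \<omega> 1(1)]] by (simp add: S_append)
    next
      case (2 \<sigma>)
      have "S \<omega> p = S (\<omega> @ \<sigma>) 0 + \<rho> ^ (k + n)"
        unfolding 2(2) S_append S[of "S \<sigma> 0 + \<rho> ^ n"] S[of "S \<sigma> 0"] by (simp add: algebra_simps power_add)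
      then show ?thesis
        using pts_right[OF words_append[OF \<omega> 2(1)]] by simp
    qed
    have ends: "S \<omega> a \<in> pts (k + n)" "S \<omega> b \<in> pts (k + n)"
      using lift net by (auto simp: net_def)
    have lt: "S \<omega> a < S \<omega> b"
      using net_less[OF net] mono[of b a] by auto
    have empty: "{S \<omega> a<..<S \<omega> b} \<inter> pts (k + n) = {}"
    proof (rule ccontr)
      assume "\<not> ?thesis"
      then obtain y where y: "S \<omega> a < y" "y < S \<omega> b" "y \<in> pts (k + n)"
        by auto
      \<comment> \<open>The ends of the copy are endpoints of level \<open>k + n\<close>, so the net
        interval beginning or ending at \<open>y\<close> cannot leave the copy.\<close>
      have ends_outside: "S \<omega> a \<le> g \<or> h \<le> S \<omega> a" "S \<omega> b \<le> g \<or> h \<le> S \<omega> b"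
        if "net (k + n) g h" for g h
        using net_pts[OF that] ends by auto
      show False
        using y(3)
      proof (cases rule: pts_cases)
        case (1 \<tau>)
        obtain h where h: "net (k + n) (S \<tau> 0) h" "h \<le> S \<tau> 0 + \<rho> ^ (k + n)"
          using net_right[OF 1(1)] by blast
        then show False
          using new[OF 1(1) _ h(2) h(1)] 1 y ends_outside[OF h(1)] by auto
      next
        case (2 \<tau>)
        obtain g where g: "net (k + n) g (S \<tau> 0 + \<rho> ^ (k + n))" "S \<tau> 0 \<le> g"
          using net_left[OF 2(1)] by blast
        then show False
          using new[OF 2(1) g(2) _ g(1)] 2 y ends_outside[OF g(1)] by auto
      qed
    qed
    obtain x where x: "x \<in> K" "a < x" "x < b"
      using net by (auto simp: net_def)
    have "S \<omega> x \<in> {S \<omega> a<..<S \<omega> b} \<inter> K"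
      using x S_in_K[OF \<omega> x(1)] mono[of x a] mono[of b x] by auto
    then have net': "net (k + n) (S \<omega> a) (S \<omega> b)"
      using ends lt empty by (auto simp: net_def)
    have "nbs n a b \<subseteq> nbs (k + n) (S \<omega> a) (S \<omega> b)"
      using old[of "S \<omega> a" "S \<omega> b"] by simp
    then have "nbs n a b = nbs (k + n) (S \<omega> a) (S \<omega> b)"
      using max[OF net'] by (intro card_seteq finite_nbs)
    with net' show ?thesis by simp
  qed
  then have "persistent n a b"
    unfolding persistent_def by (intro conjI[OF net] allI ballI)
  then show ?thesis
    by (intro exI)
qed

lemma char_child_in_char_vectors: "char_child m \<rho> d K \<alpha> \<beta> \<Longrightarrow> \<alpha> \<in> char_vectors m \<rho> d K \<and> \<beta> \<in> char_vectors m \<rho> d K"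
  unfolding char_child_def char_vectors_def net_child_def by blast

lemma admissible_path_of_rtranclp:
  assumes "(char_child m \<rho> d K)\<^sup>*\<^sup>* \<alpha> \<beta>" "\<alpha> \<in> char_vectors m \<rho> d K"
  shows "\<exists>\<gamma>. admissible_path m \<rho> d K \<gamma> \<and> set \<gamma> \<subseteq> {\<delta>. (char_child m \<rho> d K)\<^sup>*\<^sup>* \<alpha> \<delta>} \<and> hd \<gamma> = \<alpha> \<and> last \<gamma> = \<beta>"
  using assms
proof (induction rule: rtranclp_induct)
  case base
  then show ?case
    by (intro exI[of _ "[\<alpha>]"]) (auto simp: admissible_path_def)
next
  case (step \<beta> \<beta>')
  then obtain \<gamma> where \<gamma>: "admissible_path m \<rho> d K \<gamma>" "set \<gamma> \<subseteq> {\<delta>. (char_child m \<rho> d K)\<^sup>*\<^sup>* \<alpha> \<delta>}"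
      "hd \<gamma> = \<alpha>" "last \<gamma> = \<beta>"
    by blast
  have "admissible_path m \<rho> d K (\<gamma> @ [\<beta>'])"
    using \<gamma> step.hyps(2) char_child_in_char_vectors[OF step.hyps(2)]
    by (auto simp: admissible_path_def successively_append_iff)
  moreover have "(char_child m \<rho> d K)\<^sup>*\<^sup>* \<alpha> \<beta>'"
    using step.hyps by auto
  ultimately show ?case
    using \<gamma> by (intro exI[of _ "\<gamma> @ [\<beta>']"]) (auto simp: admissible_path_def)
qed

text \<open>Among the vectors reachable from \<open>\<alpha>\<close>, take one with the fewest
  reachable vectors. Whatever it reaches has the same reachable set, which is therefore strongly
  connected and closed under children.\<close>

lemma reaches_essential_class:
  assumes "\<alpha> \<in> char_vectors m \<rho> d K"
  obtains E \<beta> where "(char_child m \<rho> d K)\<^sup>*\<^sup>* \<alpha> \<beta>" "\<beta> \<in> E" "essential_class m \<rho> d K E"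
proof -
  let ?c = "char_child m \<rho> d K"
  define R where "R \<beta> = {\<gamma>. ?c\<^sup>*\<^sup>* \<beta> \<gamma>}" for \<beta>
  have in_vec: "\<gamma> \<in> char_vectors m \<rho> d K" if "?c\<^sup>*\<^sup>* \<beta> \<gamma>" "\<beta> \<in> char_vectors m \<rho> d K" for \<beta> \<gamma>
    using that by (induction rule: rtranclp_induct) (auto dest: char_child_in_char_vectors)
  obtain \<beta> where \<beta>: "?c\<^sup>*\<^sup>* \<alpha> \<beta>" "\<And>\<gamma>. ?c\<^sup>*\<^sup>* \<alpha> \<gamma> \<Longrightarrow> card (R \<beta>) \<le> card (R \<gamma>)"
    using ex_has_least_nat[of "?c\<^sup>*\<^sup>* \<alpha>" \<alpha> "\<lambda>\<beta>. card (R \<beta>)"] by auto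
  have sub: "R \<beta> \<subseteq> char_vectors m \<rho> d K"
    using in_vec[OF \<beta>(1) assms] in_vec[of \<beta>] by (auto simp: R_def)
  have R: "R \<gamma> = R \<beta>" if "\<gamma> \<in> R \<beta>" for \<gamma>
  proof (rule card_seteq)
    show "finite (R \<beta>)"
      using finite_subset[OF sub finite_char_vectors] .
    show "R \<gamma> \<subseteq> R \<beta>"
      using that by (auto simp: R_def)
    show "card (R \<beta>) \<le> card (R \<gamma>)"
      using that \<beta>(1) by (intro \<beta>(2)) (auto simp: R_def)
  qed
  have mem: "\<beta> \<in> R \<beta>"
    by (simp add: R_def)
  have "loop_class m \<rho> d K (R \<beta>)"
    unfolding loop_class_def
  proof (intro conjI ballI sub)
    show "R \<beta> \<noteq> {}"
      using mem by blast
    fix \<gamma> \<delta> assume \<gamma>: "\<gamma> \<in> R \<beta>" and \<delta>: "\<delta> \<in> R \<beta>"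
    have eq: "R \<gamma> = R \<beta>"
      using \<gamma> by (rule R)
    then have "\<delta> \<in> R \<gamma>"
      using \<delta> by (simp only:)
    then have "?c\<^sup>*\<^sup>* \<gamma> \<delta>"
      by (simp add: R_def)
    moreover have "\<gamma> \<in> char_vectors m \<rho> d K"
      using \<gamma> sub by blast
    moreover have "{\<delta>. ?c\<^sup>*\<^sup>* \<gamma> \<delta>} = R \<beta>"
      using eq by (simp only: R_def[of \<gamma>])
    ultimately show "\<exists>p. admissible_path m \<rho> d K p \<and> set p \<subseteq> R \<beta> \<and> hd p = \<gamma> \<and> last p = \<delta>"
      using admissible_path_of_rtranclp by metis
  qed
  moreover have "\<delta> \<in> R \<beta>" if "\<gamma> \<in> R \<beta>" "?c \<gamma> \<delta>" for \<gamma> \<delta>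
    using that unfolding R_def by (metis mem_Collect_eq rtranclp.rtrancl_into_rtrancl)
  ultimately have "essential_class m \<rho> d K (R \<beta>)"
    unfolding essential_class_def by blast
  with mem show ?thesis
    using that \<beta>(1) by blast
qed

lemma ex_essential_copies:
  obtains n a b where "net n a b" "\<And>k \<omega>. \<omega> \<in> W k \<Longrightarrow> essential_interval m \<rho> d K (k + n) {S \<omega> a..S \<omega> b}"
proof -
  obtain n0 a0 b0 where p0: "persistent n0 a0 b0"
    using ex_persistent by blast
  then have "char_vector m \<rho> d K n0 {a0..b0} \<in> char_vectors m \<rho> d K"
    unfolding char_vectors_def persistent_def using Icc_in_net_intervals by blast
  then obtain E \<beta> where \<beta>: "(char_child m \<rho> d K)\<^sup>*\<^sup>* (char_vector m \<rho> d K n0 {a0..b0}) \<beta>" "\<beta> \<in> E"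
      and E: "essential_class m \<rho> d K E"
    by (rule reaches_essential_class)
  obtain n a b where p: "persistent n a b" and \<beta>_eq: "\<beta> = char_vector m \<rho> d K n {a..b}"
    using persistent_reachable[OF \<beta>(1) p0] by blast
  then have net: "net n a b"
    by (simp add: persistent_def)
  then have ess: "essential_interval m \<rho> d K n {a..b}"
    using E \<beta>(2) by (auto simp: essential_interval_def Icc_in_net_intervals \<beta>_eq)
  \<comment> \<open>\<open>[a, b]\<close> is essential, but its copies agree with it only up to
    position; for a child the full vectors agree.\<close>
  obtain a' b' where c: "net (Suc n) a' b'" "a \<le> a'" "b' \<le> b"
    using net_has_child[OF net] by blast
  then have child: "net_child m \<rho> d K n {a..b} {a'..b'}"
    using net by (simp add: net_child_Icc)
  then have ess': "essential_interval m \<rho> d K (Suc n) {a'..b'}"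
    using essential_interval_child[OF ess] by blast
  obtain u w where uw: "{a'..b'} = {a + \<rho> ^ n * u..a + \<rho> ^ n * w}" "nrm_child ((b - a) / \<rho> ^ n) (nbs n a b) u w"
    using child by (rule net_child_cases)
  have ab': "a' = a + \<rho> ^ n * u" "b' = a + \<rho> ^ n * w"
    using uw(1) net_less[OF c(1)] by (auto simp: Icc_eq_Icc)
  show ?thesis
  proof (rule that[OF c(1)])
    fix k \<omega> assume \<omega>: "\<omega> \<in> W k"
    have "char_vector m \<rho> d K (k + Suc n) {S \<omega> a'..S \<omega> b'} = char_vector m \<rho> d K (Suc n) {a'..b'}"
      unfolding ab' by (rule persistent_child(2)[OF p uw(2) \<omega>])
    moreover have "net (k + Suc n) (S \<omega> a') (S \<omega> b')"
      using persistent_child(1)[OF p uw(2)] \<omega> unfolding ab' persistent_def by blast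
    ultimately show "essential_interval m \<rho> d K (k + Suc n) {S \<omega> a'..S \<omega> b'}"
      using ess' unfolding essential_interval_def Icc_in_net_intervals by simp
  qed
qed

end

section \<open>Null sets\<close>

context ifs
begin

lemma dist_K_le: "t \<in> K \<Longrightarrow> u \<in> K \<Longrightarrow> \<bar>t - u\<bar> \<le> 1"
  using subsetD[OF K_subset, of t] subsetD[OF K_subset, of u] by auto

lemma Compl_K_borel: "- K \<in> sets borel"
  by (intro borel_open open_Compl compact_imp_closed compact_K)

lemma continuous_on_ifs_map: "continuous_on A (ifs_map \<rho> d j)"
  unfolding ifs_map_def by (intro continuous_intros)

lemma continuous_on_S: "continuous_on A (S \<sigma>)"
proof -
  have "S \<sigma> = (\<lambda>x. S \<sigma> 0 + \<rho> ^ length \<sigma> * x)"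
    by (rule ext, rule S_eq)
  moreover have "continuous_on A (\<lambda>x. S \<sigma> 0 + \<rho> ^ length \<sigma> * x)"
    by (intro continuous_intros)
  ultimately show ?thesis by metis
qed

lemma infdist_ifs_map_le:
  assumes "j \<le> m"
  shows "infdist (ifs_map \<rho> d j x) K \<le> \<rho> * infdist x K"
proof -
  obtain y where y: "y \<in> K" "infdist x K = dist x y"
    using infdist_attains_inf[of K x] compact_K K_nonempty compact_imp_closed by metis
  have "infdist (ifs_map \<rho> d j x) K \<le> dist (ifs_map \<rho> d j x) (ifs_map \<rho> d j y)"
    using y(1) assms by (intro infdist_le ifs_map_in_K)
  also have "\<dots> = \<rho> * dist x y"
    using \<rho>_pos by (simp add: ifs_map_def dist_real_def abs_mult flip: right_diff_distrib)
  finally show ?thesis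
    by (simp add: y(2))
qed

end

section \<open>The self-similar measure\<close>

locale ifs_measure = ifs +
  fixes p :: "nat \<Rightarrow> real" and \<mu> :: "real measure"
  assumes p_pos: "\<And>j. j \<le> m \<Longrightarrow> 0 < p j" and p_sum: "(\<Sum>j\<le>m. p j) = 1"
    and self_similar: "self_similar_measure m \<rho> d p \<mu>"
begin

sublocale prob_space \<mu>
  using self_similar by (simp add: self_similar_measure_def)

lemma sets_\<mu> [simp, measurable_cong]: "sets \<mu> = sets borel"
  using self_similar by (simp add: self_similar_measure_def)

lemma space_\<mu> [simp]: "space \<mu> = UNIV"
  using sets_eq_imp_space_eq[OF sets_\<mu>] by simp

lemma measure_self_similar:
  assumes "A \<in> sets borel"
  shows "prob A = (\<Sum>j\<le>m. p j * prob (ifs_map \<rho> d j -` A))"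
proof -
  have meas: "ifs_map \<rho> d j \<in> measurable \<mu> borel" for j
    using borel_measurable_continuous_onI[OF continuous_on_ifs_map] by (simp cong: measurable_cong_sets)
  have "emeasure \<mu> A = (\<Sum>j\<le>m. ennreal (p j) * emeasure (distr \<mu> borel (ifs_map \<rho> d j)) A)"
    using self_similar assms by (simp add: self_similar_measure_def)
  also have "\<dots> = (\<Sum>j\<le>m. ennreal (p j) * emeasure \<mu> (ifs_map \<rho> d j -` A))"
    using assms meas by (simp add: emeasure_distr)
  also have "\<dots> = (\<Sum>j\<le>m. ennreal (p j * prob (ifs_map \<rho> d j -` A)))"
    using p_pos by (intro sum.cong refl) (simp add: emeasure_eq_measure ennreal_mult less_imp_le)
  also have "\<dots> = ennreal (\<Sum>j\<le>m. p j * prob (ifs_map \<rho> d j -` A))"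
    using p_pos by (intro sum_ennreal) (simp add: less_imp_le)
  finally have "ennreal (prob A) = ennreal (\<Sum>j\<le>m. p j * prob (ifs_map \<rho> d j -` A))"
    by (simp only: emeasure_eq_measure)
  moreover have "0 \<le> (\<Sum>j\<le>m. p j * prob (ifs_map \<rho> d j -` A))"
    using p_pos by (intro sum_nonneg mult_nonneg_nonneg) (auto simp: less_imp_le)
  ultimately show ?thesis
    by (metis ennreal_inj measure_nonneg)
qed

text \<open>Preimages of points at distance more than \<open>r\<close> from \<open>K\<close> are at
  distance more than \<open>r / \<rho>\<close>. So the mass beyond \<open>r\<close> is at most the
  mass beyond \<open>r / \<rho> ^ n\<close> for every \<open>n\<close>, which tends to 0.\<close>

lemma prob_outside_attractor: "prob (- K) = 0"
proof -
  define D where "D r = {x. r < infdist x K}" for r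
  have D: "D r \<in> sets borel" for r
    unfolding D_def by (intro borel_open open_Collect_less continuous_intros)
  have step: "prob (D r) \<le> prob (D (r / \<rho>))" for r
  proof -
    have "ifs_map \<rho> d j -` D r \<subseteq> D (r / \<rho>)" if "j \<le> m" for j
    proof
      fix x assume "x \<in> ifs_map \<rho> d j -` D r"
      then have "r < \<rho> * infdist x K"
        using infdist_ifs_map_le[OF that, of x] by (simp add: D_def)
      then show "x \<in> D (r / \<rho>)"
        using \<rho>_pos by (simp add: D_def field_simps)
    qed
    then have "prob (D r) \<le> (\<Sum>j\<le>m. p j * prob (D (r / \<rho>)))"
      unfolding measure_self_similar[OF D[of r]]
      using p_pos D by (intro sum_mono mult_left_mono finite_measure_mono) (auto simp: less_imp_le)
    also have "\<dots> = prob (D (r / \<rho>))"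
      using p_sum by (simp flip: sum_distrib_right)
    finally show ?thesis .
  qed
  have null: "prob (D r) = 0" if "0 < r" for r
  proof -
    have le: "prob (D r) \<le> prob (D (r / \<rho> ^ n))" for n
    proof (induction n)
      case (Suc n)
      then show ?case
        using step[of "r / \<rho> ^ n"] by (simp add: mult.commute)
    qed simp
    have dec: "decseq (\<lambda>n. D (r / \<rho> ^ n))"
    proof (rule decseq_SucI)
      fix n
      have "r / \<rho> ^ n \<le> r / \<rho> ^ Suc n"
        using that \<rho>_pos \<rho>_less by (intro divide_left_mono power_decreasing) auto
      then show "D (r / \<rho> ^ Suc n) \<subseteq> D (r / \<rho> ^ n)"
        by (auto simp: D_def)
    qed
    have "(\<Inter>n. D (r / \<rho> ^ n)) = {}"
    proof (intro equals0I)
      fix x assume x: "x \<in> (\<Inter>n. D (r / \<rho> ^ n))"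
      have "(\<lambda>n. infdist x K * \<rho> ^ n) \<longlonglongrightarrow> 0"
        using \<rho>_pos \<rho>_less by (intro tendsto_mult_right_zero LIMSEQ_power_zero) auto
      then have "\<forall>\<^sub>F n in sequentially. infdist x K * \<rho> ^ n < r"
        using that by (elim order_tendstoD)
      then obtain n where "infdist x K * \<rho> ^ n < r"
        by (auto simp: eventually_sequentially)
      moreover have "r / \<rho> ^ n < infdist x K"
        using x by (auto simp: D_def)
      ultimately show False
        using \<rho>_pos by (simp add: field_simps)
    qed
    moreover have "(\<lambda>n. prob (D (r / \<rho> ^ n))) \<longlonglongrightarrow> prob (\<Inter>n. D (r / \<rho> ^ n))"
      using dec D by (intro finite_Lim_measure_decseq) auto
    ultimately have "(\<lambda>n. prob (D (r / \<rho> ^ n))) \<longlonglongrightarrow> 0"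
      by simp
    then have "prob (D r) \<le> 0"
      using le by (intro LIMSEQ_le_const) auto
    then show ?thesis
      using measure_nonneg[of \<mu> "D r"] by linarith
  qed
  have "- K \<subseteq> (\<Union>n. D (1 / real (Suc n)))"
  proof
    fix x assume "x \<in> - K"
    then have "0 < infdist x K"
      using infdist_pos_not_in_closed[of K x] compact_K K_nonempty compact_imp_closed by auto
    then obtain n where "inverse (real (Suc n)) < infdist x K"
      using reals_Archimedean by blast
    then show "x \<in> (\<Union>n. D (1 / real (Suc n)))"
      by (auto simp: D_def inverse_eq_divide)
  qed
  moreover have "(\<Union>n. D (1 / real (Suc n))) \<in> null_sets \<mu>"
    using null D by (intro null_sets_UN) (simp add: null_sets_def emeasure_eq_measure)
  moreover have "- K \<in> sets borel"
    by (rule Compl_K_borel)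
  ultimately have "- K \<in> null_sets \<mu>"
    by (intro null_sets_subset[of "\<Union>n. D (1 / real (Suc n))" \<mu> "- K"]) (simp_all only: sets_\<mu>)
  then show ?thesis
    by (simp add: null_sets_def emeasure_eq_measure)
qed

lemma prob_mono_attractor:
  assumes "A \<inter> K \<subseteq> B" "A \<in> sets borel" "B \<in> sets borel"
  shows "prob A \<le> prob B"
proof -
  note K = Compl_K_borel
  have "prob A \<le> prob (B \<union> - K)"
    using assms K by (intro finite_measure_mono) auto
  also have "\<dots> \<le> prob B + prob (- K)"
    using assms K by (intro measure_Un_le) auto
  finally show ?thesis
    by (simp add: prob_outside_attractor)
qed

text \<open>Since \<open>\<mu> C\<close> is the average of the \<open>\<mu> (S\<^sub>j\<^sup>-\<^sup>1 C)\<close>, none of which exceeds it,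
  all of them are equal to \<open>\<mu> C\<close>.\<close>

lemma prob_eq_0_of_hole:
  assumes C: "C \<in> sets borel" and inv: "\<And>n \<sigma>. \<sigma> \<in> W n \<Longrightarrow> S \<sigma> -` C \<inter> K \<subseteq> C"
    and hole: "\<tau> \<in> W L" "S \<tau> -` C \<inter> K = {}"
  shows "prob C = 0"
proof -
  have meas: "S \<sigma> -` C \<in> sets borel" for \<sigma>
    using measurable_sets_borel[of "S \<sigma>" borel C] borel_measurable_continuous_onI[OF continuous_on_S] C
    by auto
  have le: "prob (S \<sigma> -` C) \<le> prob C" if "\<sigma> \<in> W n" for \<sigma> n
    using inv[OF that] meas C by (intro prob_mono_attractor)
  have "prob (S \<sigma> -` C) = prob C" if "\<sigma> \<in> W (length \<sigma>)" for \<sigma>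
    using that
  proof (induction \<sigma> rule: rev_induct)
    case (snoc j \<sigma>)
    then have \<sigma>: "\<sigma> \<in> W (length \<sigma>)" and j: "j \<le> m"
      by (auto simp: words_def)
    have S: "ifs_map \<rho> d i -` S \<sigma> -` C = S (\<sigma> @ [i]) -` C" for i
      by (auto simp: S_append)
    have "prob C = (\<Sum>i\<le>m. p i * prob (S (\<sigma> @ [i]) -` C))"
      using measure_self_similar[OF meas[of \<sigma>]] snoc.IH[OF \<sigma>] by (simp add: S)
    moreover have "prob C = (\<Sum>i\<le>m. p i * prob C)"
      using p_sum by (simp flip: sum_distrib_right)
    ultimately have "(\<Sum>i\<le>m. p i * (prob C - prob (S (\<sigma> @ [i]) -` C))) = 0"
      by (simp add: right_diff_distrib sum_subtractf)
    moreover have "0 \<le> p i * (prob C - prob (S (\<sigma> @ [i]) -` C))" if "i \<in> {..m}" for i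
      using that p_pos le[OF words_snoc[OF \<sigma>, of i]] by (simp add: less_imp_le)
    ultimately have "p j * (prob C - prob (S (\<sigma> @ [j]) -` C)) = 0"
      using j by (subst (asm) sum_nonneg_eq_0_iff) auto
    then show ?case
      using p_pos[OF j] by simp
  qed simp
  moreover have "prob (S \<tau> -` C) \<le> prob {}"
    using hole meas by (intro prob_mono_attractor) auto
  moreover have "length \<tau> = L"
    using hole(1) by (simp add: words_def)
  ultimately show ?thesis
    using hole(1) measure_nonneg[of \<mu> C] by auto
qed

end

section \<open>Hausdorff measure of a set with holes at every scale\<close>

context finite_type_ifs
begin

lemma S_image: "\<sigma> \<in> W n \<Longrightarrow> S \<sigma> ` A = (\<lambda>x. S \<sigma> 0 + \<rho> ^ n * x) ` A"
  by (intro image_cong refl S_words)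

lemma hausdorff_measure_S_image:
  assumes "\<sigma> \<in> W n"
  shows "hausdorff_measure s (S \<sigma> ` A) = ennreal ((\<rho> ^ n) powr s) * hausdorff_measure s A"
  unfolding S_image[OF assms] using \<rho>_pos by (intro hausdorff_measure_affine) auto

lemma compact_S_image: "compact A \<Longrightarrow> compact (S \<sigma> ` A)"
  by (intro compact_continuous_image continuous_on_S)

text \<open>\<open>q n\<close> measures the pieces of level \<open>n\<close> that meet
  \<open>C\<close>. Passing to level \<open>n + L\<close> loses at least \<open>c * q n\<close>,
  while \<open>q n\<close> never falls below the measure of \<open>C\<close>. \<open>margin\<close>
  keeps pieces of relative size \<open>\<rho> ^ L\<close> that touch the hole inside
  \<open>G\<close>.\<close>

lemma hausdorff_measure_eq_0_of_holes:
  assumes fin: "hausdorff_measure s K < \<infinity>"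
    and C: "C \<subseteq> K" "\<And>n \<sigma>. \<sigma> \<in> W n \<Longrightarrow> S \<sigma> ` G \<inter> C = {}"
    and \<tau>: "\<tau> \<in> W L" and margin: "\<And>x y. x \<in> K \<Longrightarrow> \<bar>y - S \<tau> x\<bar> \<le> \<rho> ^ L \<Longrightarrow> y \<in> G"
  shows "hausdorff_measure s C = 0"
proof -
  define h where "h = enn2real (hausdorff_measure s K)"
  have h: "hausdorff_measure s K = ennreal h" "0 \<le> h"
    using fin by (auto simp: h_def)
  obtain F where F: "finite F" "\<And>n \<sigma> \<tau>. \<sigma> \<in> W n \<Longrightarrow> \<tau> \<in> W n \<Longrightarrow> \<bar>S \<sigma> 0 - S \<tau> 0\<bar> \<le> \<rho> ^ n \<Longrightarrow>
      (S \<sigma> 0 - S \<tau> 0) / \<rho> ^ n \<in> F"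
    using finite_differences by blast
  have "F \<noteq> {}"
    using F(2)[of "[]" 0 "[]"] by auto
  then have cardF: "0 < real (card F)"
    using F(1) by (simp add: card_gt_0_iff)
  define A where "A n = {\<sigma> \<in> W n. S \<sigma> ` K \<inter> C \<noteq> {}}" for n
  define Q where "Q n = (\<Union>\<sigma>\<in>A n. S \<sigma> ` K)" for n
  define q where "q n = enn2real (hausdorff_measure s (Q n))" for n
  \<comment> \<open>The share of a hole in its piece, divided by a bound for the number of positions
    of pieces near a given one.\<close>
  define c where "c = (\<rho> ^ L) powr s / real (card F)"
  have c: "0 < c"
    using cardF \<rho>_pos by (simp add: c_def)
  have finA: "finite (A n)" and AW: "\<sigma> \<in> A n \<Longrightarrow> \<sigma> \<in> W n" for n \<sigma>
    using finite_words by (auto simp: A_def)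
  have QK: "Q n \<subseteq> K" for n
    by (auto simp: Q_def A_def intro: S_in_K)
  have CQ: "C \<subseteq> Q n" for n
    using C(1) K_words[of _ n] by (fastforce simp: Q_def A_def)
  have small: "hausdorff_measure s X = ennreal (enn2real (hausdorff_measure s X))" if "X \<subseteq> K" for X
    using hausdorff_measure_mono[OF that, of s] fin by (simp add: order_le_less_trans)
  have step: "q (n + L) + c * q n \<le> q n" for n
  proof -
    let ?r = "(\<rho> ^ n) powr s"
    have pos: "0 < \<rho> ^ n"
      using \<rho>_pos by simp
    obtain P where P: "P \<subseteq> (\<lambda>\<sigma>. S \<sigma> 0) ` A n"
        "\<And>x y. x \<in> P \<Longrightarrow> y \<in> P \<Longrightarrow> x \<noteq> y \<Longrightarrow> \<rho> ^ n < \<bar>x - y\<bar>"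
        "\<And>x. x \<in> (\<lambda>\<sigma>. S \<sigma> 0) ` A n \<Longrightarrow> \<exists>y\<in>P. \<bar>x - y\<bar> \<le> \<rho> ^ n"
      using maximal_separated_subset[of "(\<lambda>\<sigma>. S \<sigma> 0) ` A n" "\<rho> ^ n"] finA pos by auto
    have finP: "finite P"
      using P(1) finA finite_surj by blast
    text \<open>Upper bound: the pieces at distance at most \<open>\<rho>\<^sup>n\<close> from a given one take at most
      \<open>card F\<close> positions.\<close>
    have "Q n \<subseteq> (\<Union>(x, f)\<in>P \<times> F. (\<lambda>t. (x + \<rho> ^ n * f) + \<rho> ^ n * t) ` K)"
    proof
      fix y assume "y \<in> Q n"
      then obtain \<sigma> t where \<sigma>: "\<sigma> \<in> A n" "t \<in> K" "y = S \<sigma> t"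
        by (auto simp: Q_def)
      then obtain x where x: "x \<in> P" "\<bar>S \<sigma> 0 - x\<bar> \<le> \<rho> ^ n"
        using P(3) by blast
      then obtain \<sigma>' where \<sigma>': "\<sigma>' \<in> W n" "x = S \<sigma>' 0"
        using P(1) AW by blast
      have "(S \<sigma> 0 - x) / \<rho> ^ n \<in> F"
        using F(2)[of \<sigma> n \<sigma>'] x \<sigma>' \<sigma>(1) AW by auto
      moreover have "y = (x + \<rho> ^ n * ((S \<sigma> 0 - x) / \<rho> ^ n)) + \<rho> ^ n * t"
        using S_words[of \<sigma> n t] \<sigma> AW by auto
      ultimately show "y \<in> (\<Union>(x, f)\<in>P \<times> F. (\<lambda>t. (x + \<rho> ^ n * f) + \<rho> ^ n * t) ` K)"
        using x(1) \<sigma>(2) by blast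
    qed
    then have "hausdorff_measure s (Q n)
        \<le> hausdorff_measure s (\<Union>i\<in>P \<times> F. (\<lambda>t. (fst i + \<rho> ^ n * snd i) + \<rho> ^ n * t) ` K)"
      by (intro hausdorff_measure_mono) (simp add: case_prod_beta)
    also have "\<dots> \<le> (\<Sum>i\<in>P \<times> F. ennreal (?r * h))"
      using finP F(1) pos h
      by (intro order_trans[OF hausdorff_measure_UN_le] sum_mono)
         (simp_all add: hausdorff_measure_affine ennreal_mult)
    also have "\<dots> = ennreal (real (card P) * real (card F) * (?r * h))"
      using h by (simp add: card_cartesian_product ennreal_of_nat_eq_real_of_nat flip: ennreal_mult)
    finally have "q n \<le> real (card P) * real (card F) * (?r * h)"
      using h unfolding q_def by (intro enn2real_leI) auto
    then have upper: "c * q n \<le> real (card P) * (?r * (\<rho> ^ L) powr s * h)"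
      using cardF by (simp add: c_def field_simps)
    \<comment> \<open>Only the holes of the chosen pieces: their left ends are more than
      \<open>\<rho> ^ n\<close> apart, so these holes are disjoint and their measures add
      up.\<close>
    define T where "T = (\<Union>x\<in>P. (\<lambda>t. x + \<rho> ^ n * t) ` S \<tau> ` K)"
    have compT: "compact ((\<lambda>t. x + \<rho> ^ n * t) ` S \<tau> ` K)" for x
      by (intro compact_continuous_image[OF _ compact_S_image[OF compact_K]] continuous_intros)
    have \<tau>K: "S \<tau> ` K \<subseteq> K"
      using S_in_K[OF \<tau>] by blast
    have disj: "disjoint_family_on (\<lambda>x. (\<lambda>t. x + \<rho> ^ n * t) ` S \<tau> ` K) P"
      unfolding disjoint_family_on_def
    proof (intro ballI impI)
      fix x y assume xy: "x \<in> P" "y \<in> P" "x \<noteq> y"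
      have "\<bar>x - y\<bar> \<le> \<rho> ^ n" if "x + \<rho> ^ n * t = y + \<rho> ^ n * u" "t \<in> S \<tau> ` K" "u \<in> S \<tau> ` K" for t u
      proof -
        have "x - y = \<rho> ^ n * (u - t)"
          using that(1) by (simp add: algebra_simps)
        moreover have "\<bar>u - t\<bar> \<le> 1"
          using that(2,3) \<tau>K by (intro dist_K_le) auto
        ultimately show ?thesis
          using pos by (simp add: abs_mult mult_left_le)
      qed
      then show "(\<lambda>t. x + \<rho> ^ n * t) ` S \<tau> ` K \<inter> (\<lambda>t. y + \<rho> ^ n * t) ` S \<tau> ` K = {}"
        using P(2)[OF xy] by fastforce
    qed
    have "hausdorff_measure s T = (\<Sum>x\<in>P. ennreal (?r * (\<rho> ^ L) powr s * h))"
      unfolding T_def hausdorff_measure_UN_compact[OF finP compT disj]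
      using pos h by (simp add: hausdorff_measure_affine hausdorff_measure_S_image[OF \<tau>] ennreal_mult mult.assoc)
    also have "\<dots> = ennreal (real (card P) * (?r * (\<rho> ^ L) powr s * h))"
      using h by (simp add: ennreal_of_nat_eq_real_of_nat flip: ennreal_mult)
    finally have HT: "hausdorff_measure s T = ennreal (real (card P) * (?r * (\<rho> ^ L) powr s * h))" .
    have T_eq: "\<exists>\<sigma>\<in>A n. \<exists>t\<in>K. y = S \<sigma> (S \<tau> t)" if y: "y \<in> T" for y
    proof -
      obtain x t where x: "x \<in> P" "t \<in> K" "y = x + \<rho> ^ n * S \<tau> t"
        using y by (auto simp: T_def)
      then obtain \<sigma> where \<sigma>: "\<sigma> \<in> A n" "x = S \<sigma> 0"
        using P(1) by blast
      then have "y = S \<sigma> (S \<tau> t)"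
        using x(3) S_words[OF AW[OF \<sigma>(1)], of "S \<tau> t"] by simp
      with \<sigma>(1) x(2) show ?thesis by blast
    qed
    have TQ: "T \<subseteq> Q n"
      using T_eq \<tau>K by (force simp: Q_def)
    have QQ: "Q (n + L) \<subseteq> Q n"
    proof
      fix y assume "y \<in> Q (n + L)"
      then obtain \<sigma> t z where \<sigma>: "\<sigma> \<in> W (n + L)" "t \<in> K" "y = S \<sigma> t" "z \<in> K" "S \<sigma> z \<in> C"
        by (auto simp: Q_def A_def)
      obtain \<sigma>1 \<sigma>2 where \<sigma>12: "\<sigma> = \<sigma>1 @ \<sigma>2" "\<sigma>1 \<in> W n" "\<sigma>2 \<in> W L"
        using \<sigma>(1) by (rule words_add_cases)
      have "S \<sigma>1 (S \<sigma>2 z) \<in> C" "S \<sigma>2 z \<in> K" "S \<sigma>2 t \<in> K" "y = S \<sigma>1 (S \<sigma>2 t)"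
        using \<sigma> S_in_K[OF \<sigma>12(3)] by (auto simp: \<sigma>12(1) S_append)
      then show "y \<in> Q n"
        using \<sigma>12(2) unfolding Q_def A_def by blast
    qed
    \<comment> \<open>A smaller piece meeting a hole and \<open>C\<close> would put a point of
      \<open>C\<close> within relative distance \<open>\<rho> ^ L\<close> of the hole, hence by the
      margin into the image of \<open>G\<close> under \<open>S \<sigma>\<close>, which misses
      \<open>C\<close>.\<close>
    have TQ_disj: "Q (n + L) \<inter> T = {}"
    proof (rule ccontr)
      assume "Q (n + L) \<inter> T \<noteq> {}"
      then obtain y where y: "y \<in> Q (n + L)" "y \<in> T" by blast
      obtain \<sigma> t where \<sigma>: "\<sigma> \<in> A n" "t \<in> K" "y = S \<sigma> (S \<tau> t)"
        using T_eq[OF y(2)] by blast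
      then have \<sigma>W: "\<sigma> \<in> W n"
        using AW by blast
      obtain \<eta> u z where \<eta>: "\<eta> \<in> W (n + L)" "u \<in> K" "y = S \<eta> u" "z \<in> K" "S \<eta> z \<in> C"
        using y(1) by (auto simp: Q_def A_def)
      define w where "w = (S \<eta> z - S \<sigma> 0) / \<rho> ^ n"
      have w: "S \<eta> z = S \<sigma> w"
        unfolding S_words[OF \<sigma>W, of w] by (simp add: w_def)
      have "\<rho> ^ n * (w - S \<tau> t) = \<rho> ^ n * (\<rho> ^ L * (z - u))"
        using w \<sigma>(3) \<eta>(3) S_words[OF \<sigma>W, of w] S_words[OF \<sigma>W, of "S \<tau> t"] S_words[OF \<eta>(1), of z]
          S_words[OF \<eta>(1), of u]
        by (simp add: algebra_simps power_add)
      then have "w - S \<tau> t = \<rho> ^ L * (z - u)"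
        using pos by simp
      moreover have "\<bar>z - u\<bar> \<le> 1"
        using \<eta>(4,2) by (rule dist_K_le)
      ultimately have "\<bar>w - S \<tau> t\<bar> \<le> \<rho> ^ L"
        using \<rho>_pos by (simp add: abs_mult mult_left_le)
      then have "w \<in> G"
        using margin \<sigma>(2) by blast
      then show False
        using C(2)[OF \<sigma>W] \<eta>(5) w by auto
    qed
    have "compact (Q k)" for k
      unfolding Q_def using finA by (intro compact_UN compact_S_image compact_K)
    moreover have "compact T"
      unfolding T_def using finP compT by (intro compact_UN)
    ultimately have "hausdorff_measure s (Q (n + L)) + hausdorff_measure s T
        = hausdorff_measure s (Q (n + L) \<union> T)"
      using TQ_disj by (simp add: hausdorff_measure_Un_compact)
    also have "\<dots> \<le> hausdorff_measure s (Q n)"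
      using QQ TQ by (intro hausdorff_measure_mono) auto
    finally have "ennreal (q (n + L)) + ennreal (real (card P) * (?r * (\<rho> ^ L) powr s * h)) \<le> ennreal (q n)"
      using small[OF QK, of n] small[OF QK, of "n + L"] HT by (simp add: q_def)
    then have "q (n + L) + real (card P) * (?r * (\<rho> ^ L) powr s * h) \<le> q n"
      using h by (simp add: q_def flip: ennreal_plus)
    with upper show ?thesis by linarith
  qed
  define e where "e = enn2real (hausdorff_measure s C)"
  have eq: "e \<le> q n" for n
    unfolding e_def q_def using hausdorff_measure_mono[OF CQ, of s n] small[OF QK, of n]
    by (intro enn2real_mono) (auto simp: top.not_eq_extremum[symmetric])
  \<comment> \<open>Every step costs at least \<open>c * e\<close>, because \<open>q\<close> stays
    above \<open>e\<close>.\<close>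
  have "real k * (c * e) + q (k * L) \<le> q 0" for k
  proof (induction k)
    case (Suc k)
    have "c * e \<le> c * q (k * L)"
      using c eq by simp
    then have "c * e + q (Suc k * L) \<le> q (k * L)"
      using step[of "k * L"] by (simp add: add.commute)
    with Suc show ?case
      by (simp add: algebra_simps)
  qed simp
  then have bound: "real k * (c * e) \<le> q 0" for k
    by (smt (verit) enn2real_nonneg q_def)
  have "c * e \<le> 0"
  proof (rule ccontr)
    assume "\<not> c * e \<le> 0"
    then obtain k where "q 0 < real k * (c * e)"
      using reals_Archimedean3[of "c * e"] by auto
    with bound[of k] show False by linarith
  qed
  then have "e = 0"
    using c enn2real_nonneg[of "hausdorff_measure s C"] by (auto simp: e_def mult_le_0_iff)
  then show ?thesis
    using small[OF C(1)] by (simp add: e_def)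
qed

end

theorem proposition3p6:
  fixes m :: nat and \<rho> :: real and d p :: "nat \<Rightarrow> real"
    and K :: "real set" and \<mu> :: "real measure" and s :: real
  assumes "m \<ge> 1" and "0 < \<rho>" and "\<rho> < 1"
    and "d 0 = 0" and "strict_mono_on {..m} d"
    and "is_attractor m \<rho> d K" and "convex hull K = {0..1}"
    and "finite_type m \<rho> d"
    and "\<forall>j\<le>m. p j > 0" and "(\<Sum>j\<le>m. p j) = 1"
    and "self_similar_measure m \<rho> d p \<mu>"
    and "s = hausdorff_dim K"
  shows "\<exists>C. closed C \<and> {x \<in> K. \<not> truly_essential m \<rho> d K x} \<subseteq> C \<and>
             emeasure \<mu> C = 0 \<and> normalized_hausdorff K s C = 0"
proof -
  interpret finite_type_ifs m \<rho> d K
    by unfold_locales (use assms in auto)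
  interpret ifs_measure m \<rho> d K p \<mu>
    by unfold_locales (use assms in auto)
  obtain n a b where net: "net n a b"
    and ess: "\<And>k \<omega>. \<omega> \<in> W k \<Longrightarrow> essential_interval m \<rho> d K (k + n) {S \<omega> a..S \<omega> b}"
    using ex_essential_copies by blast
  let ?G = "{a<..<b}"
  \<comment> \<open>The empty word contributes \<open>G\<close> itself, so a piece contained in
    \<open>G\<close> is a hole of \<open>C\<close>.\<close>
  define C where "C = K - (\<Union>k. \<Union>\<omega>\<in>W k. S \<omega> ` ?G)"
  have S_Ioo: "S \<omega> ` ?G = {S \<omega> a<..<S \<omega> b}" if \<omega>: "\<omega> \<in> W k" for \<omega> k
  proof -
    have "y \<in> (\<lambda>x. S \<omega> 0 + \<rho> ^ k * x) ` ?G" if "S \<omega> a < y" "y < S \<omega> b" for y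
      using that \<rho>_pos S_words[OF \<omega>, of a] S_words[OF \<omega>, of b]
      by (intro image_eqI[of _ _ "(y - S \<omega> 0) / \<rho> ^ k"]) (auto simp: field_simps)
    then show ?thesis
      using \<rho>_pos S_words[OF \<omega>, of a] S_words[OF \<omega>, of b] by (auto simp: S_image[OF \<omega>])
  qed
  have "open (\<Union>k. \<Union>\<omega>\<in>W k. S \<omega> ` ?G)"
    by (intro open_UN ballI) (simp add: S_Ioo)
  then have closed: "closed C"
    unfolding C_def using compact_K compact_imp_closed by blast
  have CK: "C \<subseteq> K" and disj: "S \<omega> ` ?G \<inter> C = {}" if "\<omega> \<in> W k" for \<omega> k
    using that by (auto simp: C_def)
  have sub: "{x \<in> K. \<not> truly_essential m \<rho> d K x} \<subseteq> C"
  proof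
    fix x assume x: "x \<in> {x \<in> K. \<not> truly_essential m \<rho> d K x}"
    show "x \<in> C"
    proof (rule ccontr)
      assume "x \<notin> C"
      then obtain k \<omega> where \<omega>: "\<omega> \<in> W k" "x \<in> S \<omega> ` ?G"
        using x by (auto simp: C_def)
      then have "truly_essential m \<rho> d K x"
        using x truly_essential_interior[OF ess[OF \<omega>(1)], of x] by (auto simp: S_Ioo)
      with x show False by simp
    qed
  qed
  obtain x where x: "x \<in> K" "x \<in> ?G"
    using net unfolding net_def by blast
  obtain \<epsilon> where \<epsilon>: "0 < \<epsilon>" "ball x \<epsilon> \<subseteq> ?G"
    using x(2) open_contains_ball by (metis open_greaterThanLessThan)
  have "(\<lambda>j. 2 * \<rho> ^ j) \<longlonglongrightarrow> 0"
    using \<rho>_pos \<rho>_less by (intro tendsto_mult_right_zero LIMSEQ_power_zero) auto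
  then have "\<forall>\<^sub>F j in sequentially. 2 * \<rho> ^ j < \<epsilon>"
    using \<epsilon>(1) by (elim order_tendstoD)
  \<comment> \<open>One \<open>\<rho> ^ L\<close> bounds the distance from \<open>x\<close> to the
    rest of its piece, the other is the margin around the piece.\<close>
  then obtain L where L: "2 * \<rho> ^ L < \<epsilon>"
    by (auto simp: eventually_sequentially)
  obtain \<tau> t where \<tau>: "\<tau> \<in> W L" "t \<in> K" "x = S \<tau> t"
    using K_words[OF x(1)] by blast
  have margin: "z \<in> ?G" if "y \<in> K" "\<bar>z - S \<tau> y\<bar> \<le> \<rho> ^ L" for y z
  proof -
    have "x - S \<tau> y = \<rho> ^ L * (t - y)"
      unfolding \<tau>(3) S_words[OF \<tau>(1), of t] S_words[OF \<tau>(1), of y] by (simp add: algebra_simps)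
    moreover have "\<bar>t - y\<bar> \<le> 1"
      using \<tau>(2) that(1) by (rule dist_K_le)
    ultimately have "\<bar>x - S \<tau> y\<bar> \<le> \<rho> ^ L"
      using \<rho>_pos by (simp add: abs_mult mult_left_le)
    then have "dist x z < \<epsilon>"
      using that(2) L by (simp add: dist_real_def)
    then show ?thesis
      using \<epsilon>(2) by auto
  qed
  \<comment> \<open>The removed sets are carried into each other: \<open>S \<sigma>\<close> sends
    the one for \<open>\<eta>\<close> to the one for \<open>\<sigma> @ \<eta>\<close>.\<close>
  have "S \<sigma> -` C \<inter> K \<subseteq> C" if \<sigma>: "\<sigma> \<in> W k" for \<sigma> k
  proof
    fix y assume y: "y \<in> S \<sigma> -` C \<inter> K"
    have "y \<notin> S \<eta> ` ?G" if "\<eta> \<in> W j" for \<eta> j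
    proof
      assume "y \<in> S \<eta> ` ?G"
      then have "S \<sigma> y \<in> S (\<sigma> @ \<eta>) ` ?G"
        by (auto simp: S_append)
      then show False
        using y disj[OF words_append[OF \<sigma> that]] by auto
    qed
    then show "y \<in> C"
      using y by (auto simp: C_def)
  qed
  moreover have "S \<tau> -` C \<inter> K = {}"
  proof -
    have "S \<tau> y \<notin> C" if "y \<in> K" for y
    proof -
      have "S \<tau> y \<in> S [] ` ?G"
        using margin[OF that, of "S \<tau> y"] \<rho>_pos by simp
      then show ?thesis
        using disj[of "[]" 0] by auto
    qed
    then show ?thesis by blast
  qed
  ultimately have "prob C = 0"
    using closed \<tau>(1) by (intro prob_eq_0_of_hole[of C \<tau> L]) auto
  then have "emeasure \<mu> C = 0"
    by (simp add: emeasure_eq_measure)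
  moreover have "normalized_hausdorff K s C = 0"
  proof (cases "hausdorff_measure s K = \<infinity>")
    \<comment> \<open>In \<open>ennreal\<close> a quotient with infinite denominator is 0.\<close>
    case True
    then show ?thesis
      by (simp add: normalized_hausdorff_def)
  next
    case False
    have "hausdorff_measure s C = 0"
      using False CK disj \<tau>(1) margin
      by (intro hausdorff_measure_eq_0_of_holes[where G = ?G and \<tau> = \<tau> and L = L])
         (auto simp: top.not_eq_extremum)
    then have "hausdorff_measure s (C \<inter> K) = 0"
      using hausdorff_measure_mono[of "C \<inter> K" C s] by auto
    then show ?thesis
      by (simp add: normalized_hausdorff_def)
  qed
  ultimately show ?thesis
    using closed sub by blast
qed

end
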